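(* Suppose that $B\in\mathcal{B}^N_{\mathrm{iLag}}(v,\rho)$, i.e. $B$ is the vector of $\rho$-barycenters of an irreducible Laguerre tessellation with $\rho$-volumes $v$. Then there exists $\lambda_0>1$ such that for every $\lambda\in(1,\lambda_0)$: $P_{\mathcal{C}_N}(\lambda B)\in\mathcal{B}^N_{\mathrm{iLag}}(v,\rho)$, and moreover $Y^*:=\lambda B-P_{\mathcal{C}_N}(\lambda B)$ belongs to $(\mathbb{R}^d)^N\setminus\Delta_N$ and is a vector of generators associated with $P_{\mathcal{C}_N}(\lambda B)$, meaning that the Laguerre tessellation with generators $Y^*$ and $\rho$-volumes $v$ has vector of $\rho$-barycenters $P_{\mathcal{C}_N}(\lambda B)$.
   Context: Let $d,N\ge 1$ be integers. $\mathcal{P}_1(\mathbb{R}^d)$ denotes the Borel probability measures on $\mathbb{R}^d$ with finite first moment. $\rho\in\mathcal{P}_1(\mathbb{R}^d)$ is absolutely continuous with respect to Lebesgue measure with bounded density, and $v\in\mathbb{R}_{>0}^N$ satisfies $\sum_i v_i=1$. For $\mu,\nu\in\mathcal{P}_1(\mathbb{R}^d)$, $\mu\preceq_C\nu$ means $\int\varphi\,d\mu\le\int\varphi\,d\nu$ for all convex $\varphi:\mathbb{R}^d\to\mathbb{R}$. Let $\mathcal{C}_N=\mathcal{C}_N(v,\rho)=\{B\in(\mathbb{R}^d)^N:\sum_i v_i\delta_{b_i}\preceq_C\rho\}$, a nonempty compact convex set. On $(\mathbb{R}^d)^N$ use $\langle Y,Z\rangle_v=\sum_i v_i\langle y_i,z_i\rangle$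 and $\|Y\|_v^2=\langle Y,Y\rangle_v$; $P_{\mathcal{C}_N}(X)=\mathrm{argmin}\{\|B-X\|_v^2: B\in\mathcal{C}_N\}$ is the (unique) weighted orthogonal projection. $\Delta_N=\{Y\in(\mathbb{R}^d)^N: y_i=y_j\text{ for some }i<j\}$. Laguerre tessellation with $M$ cells: for $Y\in(\mathbb{R}^d)^M\setminus\Delta_M$ (generators) and $\phi\in\mathbb{R}^M$ (weights), the list of cells $L_i=\{x\in\mathbb{R}^d:\langle x,y_i\rangle-\phi_i\ge\langle x,y_j\rangle-\phi_j\ \forall j\ne i\}$. For given generators $Y$ with $N$ entries, weights exist with $\rho(L_i)=v_i$ for all $i$, and the resulting tessellation is unique up to $\rho$-null sets. A Laguerre tessellation $(L_i)_{i=1}^N$ is irreducible if there is no Laguerre tessellation $(\tilde L_j)_{j=1}^M$ with $1<M<N$ whose cells are unions of cells of $(L_i)_i$, i.e. such that for some surjective $\sigma:\{1,\ldots,N\}\to\{1,\ldots,M\}$, $\tilde L_j=\bigcup_{i\in\sigma^{-1}(j)}L_i$ for all $j$, up to $\rho$-null sets. $\mathcal{B}^N_{\mathrm{iLag}}(v,\rho)$ is the set of $B\in(\mathbb{R}^d)^N$ for which there is an irreducible Laguerre tessellation $(L_i)_{i=1}^N$ with $\rho(L_i)=v_i$ and $b_i=\frac1{v_i}\int_{L_i}x\,d\rho(x)$ for all $i$. *)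

theory Defs
  imports "HOL-Analysis.Analysis" "HOL-Probability.Probability"
begin

text \<open>
  Points of \<open>\<real>\<^sup>d\<close> have type \<open>real ^ 'd\<close> and \<open>N\<close>-tuples of points have type \<open>(real ^ 'd) ^ 'n\<close>,
  so that \<open>d = CARD('d)\<close> and \<open>N = CARD('n)\<close>, both automatically at least 1.  Laguerre
  tessellations are indexed by an arbitrary index set: \<open>UNIV :: 'n set\<close> for \<open>N\<close> cells, and
  \<open>{..<M}\<close> where the number \<open>M\<close> of cells is quantified.
\<close>

definition P1 :: "(real ^ 'd) measure set" where
  "P1 = {\<mu>. prob_space \<mu> \<and> sets \<mu> = sets borel \<and> integrable \<mu> (\<lambda>x. norm x)}"

definition has_bounded_density :: "(real ^ 'd) measure \<Rightarrow> bool" where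
  "has_bounded_density \<rho> \<longleftrightarrow>
     (\<exists>f K. f \<in> borel_measurable borel \<and> (\<forall>x. 0 \<le> f x \<and> f x \<le> (K::real)) \<and>
            \<rho> = density lborel (\<lambda>x. ennreal (f x)))"

text \<open>
  The Bochner integral is 0 on non-integrable functions, whereas a convex function may have
  integral \<open>\<infinity>\<close>.  Hence the integral in the convex order is taken in \<open>ereal\<close>.  On \<open>P1\<close> no
  \<open>\<infinity> - \<infinity>\<close> occurs: a convex function has an affine minorant, so its negative part is integrable.
\<close>

definition ext_integral :: "'a measure \<Rightarrow> ('a \<Rightarrow> real) \<Rightarrow> ereal" where
  "ext_integral \<mu> \<phi> =
     enn2ereal (\<integral>\<^sup>+ x. ennreal (\<phi> x) \<partial>\<mu>) - enn2ereal (\<integral>\<^sup>+ x. ennreal (- \<phi> x) \<partial>\<mu>)"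

lemma ext_integral_eq_integral:
  assumes "integrable \<mu> \<phi>"
  shows "ext_integral \<mu> \<phi> = ereal (integral\<^sup>L \<mu> \<phi>)"
proof -
  have eq: "enn2ereal y = ereal (enn2real y)" if "y \<noteq> \<infinity>" for y
    using that by (cases y) (auto simp: enn2ereal_ennreal)
  have a: "(\<integral>\<^sup>+ x. ennreal (\<phi> x) \<partial>\<mu>) \<noteq> \<infinity>" "(\<integral>\<^sup>+ x. ennreal (- \<phi> x) \<partial>\<mu>) \<noteq> \<infinity>"
    using assms by (auto simp: real_integrable_def)
  show ?thesis
    unfolding ext_integral_def real_lebesgue_integral_def[OF assms] eq[OF a(1)] eq[OF a(2)]
    by simp
qed

definition convex_order :: "(real ^ 'd) measure \<Rightarrow> (real ^ 'd) measure \<Rightarrow> bool"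
    (infix "\<preceq>\<^sub>C" 50) where
  "\<mu> \<preceq>\<^sub>C \<nu> \<longleftrightarrow> (\<forall>\<phi>. convex_on UNIV \<phi> \<longrightarrow> ext_integral \<mu> \<phi> \<le> ext_integral \<nu> \<phi>)"

text \<open>The measure \<open>\<Sum>\<^sub>i v\<^sub>i \<delta>\<^bsub>b\<^sub>i\<^esub>\<close>, as the image under \<open>i \<mapsto> b\<^sub>i\<close> of the weighted counting measure.\<close>

definition weighted_diracs :: "real ^ 'n \<Rightarrow> (real ^ 'd) ^ 'n \<Rightarrow> (real ^ 'd) measure" where
  "weighted_diracs v B = distr (point_measure UNIV (\<lambda>i. ennreal (v $ i))) borel (\<lambda>i. B $ i)"

lemma emeasure_weighted_diracs:
  assumes "A \<in> sets borel"
  shows "emeasure (weighted_diracs v B) A = (\<Sum>i\<in>UNIV. ennreal (v $ i) * indicator A (B $ i))"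
proof -
  have "emeasure (weighted_diracs v B) A = (\<Sum>i\<in>{i. B $ i \<in> A}. ennreal (v $ i))"
    using assms unfolding weighted_diracs_def
    by (subst emeasure_distr)
       (auto simp: vimage_def space_point_measure emeasure_point_measure_finite
             measurable_point_measure_eq1)
  also have "\<dots> = (\<Sum>i\<in>UNIV. if B $ i \<in> A then ennreal (v $ i) else 0)"
    by (simp add: sum.If_cases)
  also have "\<dots> = (\<Sum>i\<in>UNIV. ennreal (v $ i) * indicator A (B $ i))"
    by (intro sum.cong) auto
  finally show ?thesis .
qed

definition C_N :: "real ^ 'n \<Rightarrow> (real ^ 'd) measure \<Rightarrow> ((real ^ 'd) ^ 'n) set" where
  "C_N v \<rho> = {B. weighted_diracs v B \<preceq>\<^sub>C \<rho>}"

definition inner_v :: "real ^ 'n \<Rightarrow> (real ^ 'd) ^ 'n \<Rightarrow> (real ^ 'd) ^ 'n \<Rightarrow> real" where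
  "inner_v v Y Z = (\<Sum>i\<in>UNIV. v $ i * (Y $ i \<bullet> Z $ i))"

definition norm_v :: "real ^ 'n \<Rightarrow> (real ^ 'd) ^ 'n \<Rightarrow> real" where
  "norm_v v Y = sqrt (inner_v v Y Y)"

definition proj_C_N :: "real ^ 'n \<Rightarrow> (real ^ 'd) measure \<Rightarrow> (real ^ 'd) ^ 'n \<Rightarrow> (real ^ 'd) ^ 'n" where
  "proj_C_N v \<rho> X = arg_min_on (\<lambda>B. (norm_v v (B - X))\<^sup>2) (C_N v \<rho>)"

definition Delta :: "((real ^ 'd) ^ 'n) set" where
  "Delta = {Y. \<exists>i j. i \<noteq> j \<and> Y $ i = Y $ j}"

definition laguerre_cell ::
    "'i set \<Rightarrow> ('i \<Rightarrow> real ^ 'd) \<Rightarrow> ('i \<Rightarrow> real) \<Rightarrow> 'i \<Rightarrow> (real ^ 'd) set" where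
  "laguerre_cell I Y \<phi> i = {x. \<forall>j\<in>I. j \<noteq> i \<longrightarrow> x \<bullet> Y i - \<phi> i \<ge> x \<bullet> Y j - \<phi> j}"

definition laguerre_tessellation :: "'i set \<Rightarrow> ('i \<Rightarrow> (real ^ 'd) set) \<Rightarrow> bool" where
  "laguerre_tessellation I L \<longleftrightarrow>
     (\<exists>Y \<phi>. inj_on Y I \<and> (\<forall>i\<in>I. L i = laguerre_cell I Y \<phi> i))"

definition irreducible_laguerre ::
    "(real ^ 'd) measure \<Rightarrow> ('n::finite \<Rightarrow> (real ^ 'd) set) \<Rightarrow> bool" where
  "irreducible_laguerre \<rho> L \<longleftrightarrow>
     laguerre_tessellation UNIV L \<and>
     \<not> (\<exists>(M::nat) L' (\<sigma> :: 'n \<Rightarrow> nat).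
           1 < M \<and> M < CARD('n) \<and> laguerre_tessellation {..<M} L' \<and> range \<sigma> = {..<M} \<and>
           (\<forall>j<M. AE x in \<rho>. x \<in> L' j \<longleftrightarrow> x \<in> (\<Union>i\<in>\<sigma> -` {j}. L i)))"

definition has_volumes ::
    "(real ^ 'd) measure \<Rightarrow> real ^ 'n \<Rightarrow> ('n \<Rightarrow> (real ^ 'd) set) \<Rightarrow> bool" where
  "has_volumes \<rho> v L \<longleftrightarrow> (\<forall>i. measure \<rho> (L i) = v $ i)"

definition has_barycenters ::
    "(real ^ 'd) measure \<Rightarrow> real ^ 'n \<Rightarrow> ('n \<Rightarrow> (real ^ 'd) set) \<Rightarrow> (real ^ 'd) ^ 'n \<Rightarrow> bool" where
  "has_barycenters \<rho> v L B \<longleftrightarrow> (\<forall>i. B $ i = (1 / v $ i) *\<^sub>R (LINT x:L i|\<rho>. x))"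

definition B_iLag :: "real ^ 'n \<Rightarrow> (real ^ 'd) measure \<Rightarrow> ((real ^ 'd) ^ 'n) set" where
  "B_iLag v \<rho> =
     {B. \<exists>L. irreducible_laguerre \<rho> L \<and> has_volumes \<rho> v L \<and> has_barycenters \<rho> v L B}"

text \<open>
  \<open>Y\<close> is a vector of generators associated with \<open>B\<close>.  The tessellation with generators \<open>Y\<close>
  and volumes \<open>v\<close> is only determined up to \<open>\<rho>\<close>-null sets (the weights \<open>\<phi>\<close> are not unique), so
  we require that admissible weights exist and that all of them yield the barycenters \<open>B\<close>.
\<close>

definition generators_of ::
    "real ^ 'n \<Rightarrow> (real ^ 'd) measure \<Rightarrow> (real ^ 'd) ^ 'n \<Rightarrow> (real ^ 'd) ^ 'n \<Rightarrow> bool" where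
  "generators_of v \<rho> Y B \<longleftrightarrow>
     Y \<notin> Delta \<and>
     (\<exists>\<phi>. has_volumes \<rho> v (laguerre_cell UNIV (($) Y) \<phi>)) \<and>
     (\<forall>\<phi>. has_volumes \<rho> v (laguerre_cell UNIV (($) Y) \<phi>) \<longrightarrow>
           has_barycenters \<rho> v (laguerre_cell UNIV (($) Y) \<phi>) B)"

end

theory Submission
  imports Defs
begin

text \<open>
  \<open>Y\<^sup>* = \<lambda>B - P\<close> lies in the normal cone of \<open>C\<^sub>N\<close> at the projection \<open>P\<close>.  Testing the convex
  order with \<open>\<Phi>(x) = max\<^sub>i (\<langle>x, y\<^sub>i\<rangle> - \<phi>\<^sub>i)\<close> bounds the support function of \<open>C\<^sub>N\<close> at \<open>Y\<close> by
  \<open>\<integral>\<Phi> d\<rho> + \<Sum>\<^sub>i v\<^sub>i \<phi>\<^sub>i\<close>, with equality at the barycenters of the tessellation \<open>(Y, \<phi>)\<close> of volumes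
  \<open>v\<close>; if \<open>Y \<notin> \<Delta>\<^sub>N\<close>, differentiating this bound in \<open>Y\<close> shows that those barycenters are the only
  maximizer.  A nonconstant normal vector \<open>Y \<in> \<Delta>\<^sub>N\<close> at \<open>B\<close> merges cells into a coarser Laguerre
  tessellation and conversely, so irreducibility means that the normal cone meets \<open>\<Delta>\<^sub>N\<close> only in
  constant vectors.  By compactness this persists at points of \<open>C\<^sub>N\<close> near \<open>B\<close>, in particular at
  \<open>P\<close> for \<open>\<lambda>\<close> close to 1.  Finally \<open>Y\<^sup>*\<close> is not constant, since
  \<open>\<langle>Y\<^sup>*, G\<rangle>\<^sub>v \<ge> (\<lambda> - 1) \<langle>B, G\<rangle>\<^sub>v > 0\<close> for generators \<open>G\<close> of \<open>B\<close> with \<open>\<Sum>\<^sub>i v\<^sub>i g\<^sub>i = 0\<close>.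
\<close>

section \<open>Laguerre cells and their upper envelope\<close>

text \<open>The potential conjugate to the weights: a convex piecewise affine function whose pieces
  live on the Laguerre cells. \<open>Max\<close> is meaningful only for finite nonempty
  \<open>I\<close>.\<close>

definition envelope :: "'i set \<Rightarrow> ('i \<Rightarrow> 'a::real_inner) \<Rightarrow> ('i \<Rightarrow> real) \<Rightarrow> 'a \<Rightarrow> real" where
  "envelope I Y \<phi> x = Max ((\<lambda>i. x \<bullet> Y i - \<phi> i) ` I)"

lemma envelope_ge: "finite I \<Longrightarrow> i \<in> I \<Longrightarrow> x \<bullet> Y i - \<phi> i \<le> envelope I Y \<phi> x"
  unfolding envelope_def by (intro Max_ge) auto

lemma envelope_attained:
  assumes "finite I" "I \<noteq> {}"
  obtains i where "i \<in> I" "envelope I Y \<phi> x = x \<bullet> Y i - \<phi> i"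
proof -
  have "envelope I Y \<phi> x \<in> (\<lambda>i. x \<bullet> Y i - \<phi> i) ` I"
    unfolding envelope_def using assms by (intro Max_in) auto
  then show ?thesis using that by auto
qed

lemma envelope_le:
  assumes "finite I" "I \<noteq> {}" "\<And>i. i \<in> I \<Longrightarrow> x \<bullet> Y i - \<phi> i \<le> c"
  shows "envelope I Y \<phi> x \<le> c"
  using assms unfolding envelope_def by (subst Max_le_iff) auto

lemma mem_laguerre_cell_iff:
  assumes "finite I" "i \<in> I"
  shows "x \<in> laguerre_cell I Y \<phi> i \<longleftrightarrow> envelope I Y \<phi> x = x \<bullet> Y i - \<phi> i"
proof
  assume "x \<in> laguerre_cell I Y \<phi> i"
  then have "x \<bullet> Y j - \<phi> j \<le> x \<bullet> Y i - \<phi> i" if "j \<in> I" for j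
    using that by (cases "j = i") (auto simp: laguerre_cell_def)
  then have "envelope I Y \<phi> x \<le> x \<bullet> Y i - \<phi> i"
    using assms by (intro envelope_le) auto
  then show "envelope I Y \<phi> x = x \<bullet> Y i - \<phi> i"
    using envelope_ge[OF assms, of x Y \<phi>] by simp
next
  assume "envelope I Y \<phi> x = x \<bullet> Y i - \<phi> i"
  then show "x \<in> laguerre_cell I Y \<phi> i"
    using envelope_ge[OF assms(1), of _ x Y \<phi>] by (auto simp: laguerre_cell_def)
qed

lemma convex_on_envelope:
  assumes "finite I" "I \<noteq> {}"
  shows "convex_on UNIV (envelope I Y \<phi>)"
proof (rule convex_onI)
  fix t :: real and x y :: 'b
  assume t: "0 < t" "t < 1"
  show "envelope I Y \<phi> ((1 - t) *\<^sub>R x + t *\<^sub>R y)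
          \<le> (1 - t) * envelope I Y \<phi> x + t * envelope I Y \<phi> y"
  proof (rule envelope_le[OF assms])
    fix i assume i: "i \<in> I"
    have "((1 - t) *\<^sub>R x + t *\<^sub>R y) \<bullet> Y i - \<phi> i
            = (1 - t) * (x \<bullet> Y i - \<phi> i) + t * (y \<bullet> Y i - \<phi> i)"
      by (simp add: inner_add_left algebra_simps)
    also have "\<dots> \<le> (1 - t) * envelope I Y \<phi> x + t * envelope I Y \<phi> y"
      using t i assms by (intro add_mono mult_left_mono envelope_ge) auto
    finally show "((1 - t) *\<^sub>R x + t *\<^sub>R y) \<bullet> Y i - \<phi> i \<le> \<dots>" .
  qed
qed auto

lemma closed_laguerre_cell: "closed (laguerre_cell I Y \<phi> i)"
proof -
  have "laguerre_cell I Y \<phi> i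
          = (\<Inter>j\<in>I - {i}. {x. x \<bullet> Y j - \<phi> j \<le> x \<bullet> Y i - \<phi> i})"
    by (auto simp: laguerre_cell_def)
  moreover have "closed {x. x \<bullet> Y j - \<phi> j \<le> x \<bullet> Y i - \<phi> i}" for j
    by (intro closed_Collect_le continuous_intros)
  ultimately show ?thesis
    by auto
qed

lemma laguerre_cell_reindex:
  assumes "bij_betw e J I" "j \<in> J"
  shows "laguerre_cell J (\<lambda>j. Y (e j)) (\<lambda>j. \<phi> (e j)) j = laguerre_cell I Y \<phi> (e j)"
proof -
  have "I = e ` J" "\<And>i. i \<in> J \<Longrightarrow> e i = e j \<longleftrightarrow> i = j"
    using assms by (auto simp: bij_betw_def inj_on_def)
  then show ?thesis
    by (auto simp: laguerre_cell_def)
qed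

text \<open>A hyperplane separates \<open>(b, \<psi> b)\<close> from the strict epigraph. It is not
  vertical because \<open>\<psi>\<close> is finite everywhere, so it is the graph of an affine
  minorant touching at \<open>b\<close>.\<close>

lemma convex_on_supporting_affine:
  fixes \<psi> :: "'a::euclidean_space \<Rightarrow> real"
  assumes cvx: "convex_on UNIV \<psi>"
  obtains a where "\<And>x. \<psi> b + a \<bullet> (x - b) \<le> \<psi> x"
proof -
  \<comment> \<open>Strict epigraph, translated so that the touching point becomes the
    origin.\<close>
  define S where "S = {(x, t). \<psi> (x + b) < t + \<psi> b}"
  have "convex S"
  proof (rule convexI)
    fix p q :: "'a \<times> real" and u w :: real
    assume pq: "p \<in> S" "q \<in> S" and uw: "0 \<le> u" "0 \<le> w" "u + w = 1"
    obtain x s where p: "p = (x, s)" by (cases p)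
    obtain y t where q: "q = (y, t)" by (cases q)
    have "(u *\<^sub>R x + w *\<^sub>R y) + b = u *\<^sub>R (x + b) + w *\<^sub>R (y + b)"
      using uw(3) by (simp add: algebra_simps flip: scaleR_add_left)
    then have "\<psi> ((u *\<^sub>R x + w *\<^sub>R y) + b) \<le> u * \<psi> (x + b) + w * \<psi> (y + b)"
      using cvx uw unfolding convex_on_def by auto
    also have "\<dots> < u * (s + \<psi> b) + w * (t + \<psi> b)"
    \<comment> \<open>Strictness passes to the combination only through a point of positive
      weight.\<close>
    proof (cases "u = 0")
      case True
      then show ?thesis using pq(2) uw by (simp add: S_def q)
    next
      case False
      then have "u * \<psi> (x + b) < u * (s + \<psi> b)"
        using pq(1) uw by (simp add: S_def p)
      moreover have "w * \<psi> (y + b) \<le> w * (t + \<psi> b)"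
        using pq(2) uw by (intro mult_left_mono) (auto simp: S_def q)
      ultimately show ?thesis by simp
    qed
    also have "\<dots> = u * s + w * t + (u + w) * \<psi> b"
      by (simp add: algebra_simps)
    finally show "u *\<^sub>R p + w *\<^sub>R q \<in> S"
      using uw(3) by (simp add: S_def p q)
  qed
  moreover have "0 \<notin> S"
    by (simp add: S_def zero_prod_def)
  ultimately obtain c where c: "c \<noteq> 0" "\<forall>z\<in>S. 0 \<le> c \<bullet> z"
    using separating_hyperplane_set_0[of S] by blast
  obtain p s where ps: "c = (p, s)" by (cases c)
  have pos: "0 \<le> p \<bullet> x + s * t" if "\<psi> (x + b) < t + \<psi> b" for x t
    using c(2) that by (auto simp: S_def ps)
  have s: "0 \<le> s"
    using pos[of 0 1] by simp
  have "s \<noteq> 0"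
  proof
    assume "s = 0"
    then have "0 \<le> p \<bullet> (- p)"
      using pos[of "- p" "\<psi> (- p + b) - \<psi> b + 1"] by simp
    then have "p = 0"
      by (metis inner_gt_zero_iff inner_minus_right leD neg_0_less_iff_less neg_less_0_iff_less not_less)
    then show False
      using c(1) \<open>s = 0\<close> by (simp add: ps zero_prod_def)
  qed
  with s have s: "0 < s" by simp
  show ?thesis
  proof (rule that)
    fix x
    \<comment> \<open>Points of the graph are not in the strict epigraph, so the bound is first
      shown with slack \<open>e\<close>.\<close>
    have "\<psi> b - (p /\<^sub>R s) \<bullet> (x - b) \<le> \<psi> x + e" if "e > 0" for e
    proof -
      have "0 \<le> p \<bullet> (x - b) + s * (\<psi> x - \<psi> b + e)"
        using that by (intro pos) auto
      then have "0 \<le> (p \<bullet> (x - b)) / s + (\<psi> x - \<psi> b + e)"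
        using s by (simp add: field_simps)
      then show ?thesis
        by (simp add: divide_inverse mult.commute)
    qed
    then have "\<psi> b - (p /\<^sub>R s) \<bullet> (x - b) \<le> \<psi> x"
      by (rule field_le_epsilon)
    then show "\<psi> b + (- (p /\<^sub>R s)) \<bullet> (x - b) \<le> \<psi> x"
      by simp
  qed
qed

section \<open>Null sets and integrability under an absolutely continuous measure\<close>

locale ac_P1 =
  fixes \<rho> :: "(real ^ 'd) measure"
  assumes rho_P1: "\<rho> \<in> P1"
    and rho_density: "has_bounded_density \<rho>"
begin

sublocale prob_space \<rho>
  using rho_P1 by (simp add: P1_def)

lemma sets_rho [measurable_cong]: "sets \<rho> = sets borel"
  using rho_P1 by (simp add: P1_def)

lemma space_rho [simp]: "space \<rho> = UNIV"
  using sets_eq_imp_space_eq[OF sets_rho] by simp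

lemma prob_UNIV [simp]: "prob UNIV = 1"
  using prob_space by simp

lemma integrable_rho_id [simp, intro]: "integrable \<rho> (\<lambda>x. x)"
  using rho_P1 by (subst integrable_norm_iff[symmetric]) (auto simp: P1_def)

text \<open>The density makes Lebesgue null sets \<open>\<rho>\<close>-null; absolute continuity
  enters through this fact.\<close>

lemma AE_hyperplane:
  assumes "a \<noteq> 0"
  shows "AE x in \<rho>. x \<bullet> a \<noteq> c"
proof -
  obtain f where f: "f \<in> borel_measurable borel" "\<rho> = density lborel (\<lambda>x. ennreal (f x))"
    using rho_density unfolding has_bounded_density_def by auto
  have "negligible {x. a \<bullet> x = c}"
    using assms by (intro negligible_hyperplane) auto
  moreover have "{x. a \<bullet> x = c} \<in> sets lborel"
    by simp
  ultimately have "{x. a \<bullet> x = c} \<in> null_sets lborel"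
    by (metis negligible_iff_null_sets null_sets_completion_iff)
  then have "AE x in lborel. a \<bullet> x \<noteq> c"
    using AE_not_in by force
  then show ?thesis
    using f by (auto simp: AE_density inner_commute)
qed

text \<open>A tie between two generators lies on a hyperplane with normal \<open>Y i - Y j\<close>,
  and there are finitely many pairs.\<close>

lemma AE_distinct:
  assumes "finite I" "inj_on Y I"
  shows "AE x in \<rho>. \<forall>i\<in>I. \<forall>j\<in>I. i \<noteq> j \<longrightarrow> x \<bullet> Y i - \<phi> i \<noteq> x \<bullet> Y j - \<phi> j"
proof -
  have "AE x in \<rho>. i \<noteq> j \<longrightarrow> x \<bullet> Y i - \<phi> i \<noteq> x \<bullet> Y j - \<phi> j"
    if "i \<in> I" "j \<in> I" for i j
  proof (cases "i = j")
    case False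
    then have "Y i - Y j \<noteq> 0"
      using assms(2) that by (auto simp: inj_on_def)
    from AE_hyperplane[OF this, of "\<phi> i - \<phi> j"] show ?thesis
      by eventually_elim (auto simp: inner_diff_right)
  qed simp
  then show ?thesis
    using assms(1) by (simp add: AE_finite_all)
qed

lemma AE_unique_cell:
  assumes "finite I" "I \<noteq> {}" "inj_on Y I"
  shows "AE x in \<rho>. \<exists>i\<in>I. \<forall>j\<in>I. x \<in> laguerre_cell I Y \<phi> j \<longleftrightarrow> j = i"
  using AE_distinct[OF assms(1,3), of \<phi>]
proof eventually_elim
  case (elim x)
  obtain i where i: "i \<in> I" "envelope I Y \<phi> x = x \<bullet> Y i - \<phi> i"
    using envelope_attained[OF assms(1,2)] by metis
  have "x \<in> laguerre_cell I Y \<phi> j \<longleftrightarrow> j = i" if "j \<in> I" for j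
    using that i elim assms(1) by (auto simp: mem_laguerre_cell_iff)
  then show ?case
    using i by blast
qed

lemma laguerre_cell_measurable [measurable]: "laguerre_cell I Y \<phi> i \<in> sets borel"
  using closed_laguerre_cell by (rule borel_closed)

lemma AE_sum_indicator_cells:
  assumes "finite I" "I \<noteq> {}" "inj_on Y I"
  shows "AE x in \<rho>. (\<Sum>i\<in>I. indicator (laguerre_cell I Y \<phi> i) x) = (1::real)"
  using AE_unique_cell[OF assms, of \<phi>]
proof eventually_elim
  case (elim x)
  then obtain k where k: "k \<in> I" "\<And>j. j \<in> I \<Longrightarrow> x \<in> laguerre_cell I Y \<phi> j \<longleftrightarrow> j = k"
    by auto
  then have "(\<Sum>i\<in>I. indicator (laguerre_cell I Y \<phi> i) x) = (\<Sum>i\<in>I. if i = k then 1 else (0::real))"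
    by (intro sum.cong) (auto simp: indicator_def)
  then show ?case
    using k assms(1) by simp
qed

lemma sum_volumes:
  assumes "finite I" "I \<noteq> {}" "inj_on Y I"
  shows "(\<Sum>i\<in>I. measure \<rho> (laguerre_cell I Y \<phi> i)) = 1"
proof -
  have "(\<Sum>i\<in>I. measure \<rho> (laguerre_cell I Y \<phi> i))
          = (LINT x|\<rho>. (\<Sum>i\<in>I. indicator (laguerre_cell I Y \<phi> i) x))"
    by (subst Bochner_Integration.integral_sum)
       (auto intro!: integrable_real_indicator simp: sets_rho less_top[symmetric])
  also have "\<dots> = (LINT x|\<rho>. 1)"
    by (rule integral_cong_AE) (use AE_sum_indicator_cells[OF assms, of \<phi>] in auto)
  finally show ?thesis
    by simp
qed

lemma envelope_measurable [measurable]: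
  fixes Y :: "'i \<Rightarrow> real ^ 'd"
  assumes [simp]: "finite I"
  shows "envelope I Y \<phi> \<in> borel_measurable borel"
  unfolding envelope_def[abs_def] by (intro borel_measurable_Max) auto

lemma integrable_envelope [simp, intro]:
  assumes "finite I" "I \<noteq> {}"
  shows "integrable \<rho> (envelope I Y \<phi>)"
proof (rule Bochner_Integration.integrable_bound)
  show "integrable \<rho> (\<lambda>x. \<Sum>i\<in>I. \<bar>x \<bullet> Y i - \<phi> i\<bar>)"
    by (intro Bochner_Integration.integrable_sum integrable_abs Bochner_Integration.integrable_diff
          integrable_inner_left) auto
  show "envelope I Y \<phi> \<in> borel_measurable \<rho>"
    using assms by measurable
  have "\<bar>envelope I Y \<phi> x\<bar> \<le> (\<Sum>i\<in>I. \<bar>x \<bullet> Y i - \<phi> i\<bar>)" for x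
  proof -
    obtain i where "i \<in> I" "envelope I Y \<phi> x = x \<bullet> Y i - \<phi> i"
      using envelope_attained[OF assms] by metis
    then show ?thesis
      using assms by (auto intro!: member_le_sum)
  qed
  then show "AE x in \<rho>. norm (envelope I Y \<phi> x) \<le> norm (\<Sum>i\<in>I. \<bar>x \<bullet> Y i - \<phi> i\<bar>)"
    by (auto simp: sum_nonneg)
qed


section \<open>Existence of weights with prescribed volumes\<close>

text \<open>A maximum moves by at most the largest change of its terms. The reverse bound follows by
  swapping \<open>\<phi>\<close> and \<open>\<phi>'\<close>. Weights are vectors here so that
  compact boxes are available for the minimization.\<close>

lemma integral_envelope_lipschitz:
  fixes \<phi> \<phi>' :: "real ^ 'n"
  assumes "finite I" "I \<noteq> {}"
  shows "(LINT x|\<rho>. envelope I Y (($) \<phi>) x) \<le> (LINT x|\<rho>. envelope I Y (($) \<phi>') x) + dist \<phi> \<phi>'"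
proof -
  have "envelope I Y (($) \<phi>) x \<le> envelope I Y (($) \<phi>') x + dist \<phi> \<phi>'" for x
  proof (rule envelope_le[OF assms])
    fix i assume "i \<in> I"
    then have "x \<bullet> Y i - \<phi>' $ i \<le> envelope I Y (($) \<phi>') x"
      using assms by (intro envelope_ge)
    moreover have "\<phi>' $ i - \<phi> $ i \<le> dist \<phi> \<phi>'"
      using component_le_norm_cart[of "\<phi>' - \<phi>" i] by (simp add: dist_norm norm_minus_commute)
    ultimately show "x \<bullet> Y i - \<phi> $ i \<le> envelope I Y (($) \<phi>') x + dist \<phi> \<phi>'"
      by simp
  qed
  then have "(LINT x|\<rho>. envelope I Y (($) \<phi>) x)
               \<le> (LINT x|\<rho>. envelope I Y (($) \<phi>') x + dist \<phi> \<phi>')"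
    using assms by (intro integral_mono) auto
  then show ?thesis
    using assms by simp
qed

text \<open>The dual functional of semi-discrete optimal transport. For distinct generators its
  derivative in \<open>\<phi> $ i\<close> is \<open>V i\<close> minus the volume of cell
  \<open>i\<close>, so its minimizers are the weights with volumes \<open>V\<close>.\<close>

definition dual_cost :: "'n set \<Rightarrow> ('n \<Rightarrow> real ^ 'd) \<Rightarrow> ('n \<Rightarrow> real) \<Rightarrow> real ^ 'n \<Rightarrow> real" where
  "dual_cost I Y V \<phi> = (LINT x|\<rho>. envelope I Y (($) \<phi>) x) + (\<Sum>i\<in>I. V i * \<phi> $ i)"

text \<open>Since \<open>V\<close> sums to 1, adding a constant to \<open>\<phi>\<close> does not
  change the cost. After normalizing the least weight to 0 the cost is coercive, and a minimizer
  over a compact box is a global one.\<close>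

lemma dual_cost_minimizer:
  fixes Y :: "'n::finite \<Rightarrow> real ^ 'd"
  assumes I: "I \<noteq> {}" and V: "\<And>i. i \<in> I \<Longrightarrow> 0 < V i" "(\<Sum>i\<in>I. V i) = 1"
  obtains \<phi> where "\<And>\<phi>'. dual_cost I Y V \<phi> \<le> dual_cost I Y V \<phi>'"
proof -
  have fin: "finite I" by simp
  \<comment> \<open>\<open>c\<close> bounds the integral of the envelope below once some weight is
    0, and \<open>w\<close> is the least target volume. \<open>K\<close> solves
    \<open>c + w * K = dual_cost I Y V 0\<close>, so a normalized vector with an entry above
    \<open>K\<close> costs more than 0.\<close>
  define c where "c = Min ((\<lambda>i. LINT x|\<rho>. x \<bullet> Y i) ` I)"
  define w where "w = Min (V ` I)"
  define K where "K = (dual_cost I Y V 0 - c) / w"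
  have w: "0 < w"
    unfolding w_def using I V by (subst Min_gr_iff) auto
  have coercive: "c + w * \<phi> $ k \<le> dual_cost I Y V \<phi>"
    if nonneg: "\<And>i. i \<in> I \<Longrightarrow> 0 \<le> \<phi> $ i" and j: "j \<in> I" "\<phi> $ j = 0" and k: "k \<in> I" for \<phi> j k
  proof -
    have "c \<le> (LINT x|\<rho>. x \<bullet> Y j)"
      unfolding c_def using j by (intro Min_le) auto
    also have "\<dots> \<le> (LINT x|\<rho>. envelope I Y (($) \<phi>) x)"
      using envelope_ge[OF fin j(1), of _ Y "($) \<phi>"] j I by (intro integral_mono) auto
    finally have 1: "c \<le> (LINT x|\<rho>. envelope I Y (($) \<phi>) x)" .
    have "w * \<phi> $ k \<le> V k * \<phi> $ k"
      unfolding w_def using k nonneg by (intro mult_right_mono Min_le) auto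
    also have "\<dots> \<le> (\<Sum>i\<in>I. V i * \<phi> $ i)"
      using k nonneg V(1) by (intro member_le_sum) (auto intro: mult_nonneg_nonneg less_imp_le)
    finally show ?thesis
      using 1 by (simp add: dual_cost_def)
  qed
  have "0 \<le> K"
  proof -
    obtain k where "k \<in> I" using I by auto
    then have "c \<le> dual_cost I Y V 0"
      using coercive[of 0 k k] by simp
    then show ?thesis using w by (simp add: K_def)
  qed
  have "continuous_on UNIV (\<lambda>\<phi>. LINT x|\<rho>. envelope I Y (($) \<phi>) x)"
  proof (rule lipschitz_on_continuous_on)
    show "1-lipschitz_on UNIV (\<lambda>\<phi>. LINT x|\<rho>. envelope I Y (($) \<phi>) x)"
    proof (rule lipschitz_onI)
      fix \<phi> \<phi>' :: "real ^ 'n"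
      show "dist (LINT x|\<rho>. envelope I Y (($) \<phi>) x) (LINT x|\<rho>. envelope I Y (($) \<phi>') x)
              \<le> 1 * dist \<phi> \<phi>'"
        using integral_envelope_lipschitz[OF fin I, of Y \<phi> \<phi>']
          integral_envelope_lipschitz[OF fin I, of Y \<phi>' \<phi>]
        by (simp add: dist_real_def abs_le_iff dist_commute)
    qed simp
  qed
  then have cont: "continuous_on (cbox 0 (\<chi> i. K)) (dual_cost I Y V)"
    unfolding dual_cost_def[abs_def]
    by (intro continuous_intros) (auto intro: continuous_on_subset)
  have zero: "(0 :: real ^ 'n) \<in> cbox 0 (\<chi> i. K)"
    using \<open>0 \<le> K\<close> by (auto simp: cbox_def Basis_vec_def inner_axis)
  then obtain \<phi> where \<phi>: "\<phi> \<in> cbox 0 (\<chi> i. K)"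
    "\<And>\<phi>'. \<phi>' \<in> cbox 0 (\<chi> i. K) \<Longrightarrow> dual_cost I Y V \<phi> \<le> dual_cost I Y V \<phi>'"
    using continuous_attains_inf[OF compact_cbox _ cont] by blast
  have "dual_cost I Y V \<phi> \<le> dual_cost I Y V \<phi>'" for \<phi>'
  proof -
    \<comment> \<open>\<open>\<phi>''\<close> is \<open>\<phi>'\<close> shifted to have least weight
      0 on \<open>I\<close>; it is 0 outside \<open>I\<close> so that it can lie in the box.\<close>
    obtain j where j: "j \<in> I" "\<And>i. i \<in> I \<Longrightarrow> \<phi>' $ j \<le> \<phi>' $ i"
      using I fin by (metis arg_min_if_finite(1) arg_min_least)
    define \<phi>'' :: "real ^ 'n" where "\<phi>'' = (\<chi> i. if i \<in> I then \<phi>' $ i - \<phi>' $ j else 0)"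
    have "envelope I Y (($) \<phi>'') x = envelope I Y (($) \<phi>') x + \<phi>' $ j" for x
    proof (rule antisym)
      show "envelope I Y (($) \<phi>'') x \<le> envelope I Y (($) \<phi>') x + \<phi>' $ j"
        using envelope_ge[OF fin, of _ x Y "($) \<phi>'"] I
        by (intro envelope_le) (auto simp: \<phi>''_def algebra_simps)
      have "envelope I Y (($) \<phi>') x \<le> envelope I Y (($) \<phi>'') x - \<phi>' $ j"
        using envelope_ge[OF fin, of _ x Y "($) \<phi>''"] I
        by (intro envelope_le) (auto simp: \<phi>''_def algebra_simps)
      then show "envelope I Y (($) \<phi>') x + \<phi>' $ j \<le> envelope I Y (($) \<phi>'') x"
        by simp
    qed
    moreover have "(\<Sum>i\<in>I. V i * \<phi>'' $ i) = (\<Sum>i\<in>I. V i * \<phi>' $ i) - \<phi>' $ j"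
      using V(2) by (simp add: \<phi>''_def algebra_simps sum_subtractf flip: sum_distrib_right)
    ultimately have eq: "dual_cost I Y V \<phi>'' = dual_cost I Y V \<phi>'"
      using I by (simp add: dual_cost_def)
    show ?thesis
    proof (cases "\<forall>k\<in>I. \<phi>'' $ k \<le> K")
      case True
      then have "\<phi>'' \<in> cbox 0 (\<chi> i. K)"
        using \<open>0 \<le> K\<close> j by (auto simp: cbox_def Basis_vec_def inner_axis \<phi>''_def)
      then show ?thesis
        using \<phi>(2) eq by metis
    next
      case False
      then obtain k where k: "k \<in> I" "K < \<phi>'' $ k" by force
      have "dual_cost I Y V \<phi> \<le> dual_cost I Y V 0"
        using zero by (rule \<phi>(2))
      also have "\<dots> = c + w * K"
        using w by (simp add: K_def)
      also have "\<dots> \<le> c + w * \<phi>'' $ k"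
        using k w by simp
      also have "\<dots> \<le> dual_cost I Y V \<phi>''"
        using j k by (intro coercive) (auto simp: \<phi>''_def)
      finally show ?thesis
        using eq by simp
    qed
  qed
  then show ?thesis by (rule that)
qed

text \<open>Raising \<open>\<phi>\<^sub>i\<close> by \<open>t\<close> lowers the envelope by \<open>t\<close> wherever \<open>i\<close> leads by at least \<open>t\<close>.  This
  one-sided estimate suffices for equality of volumes, because both sides sum to 1.\<close>

lemma volume_le_of_minimizer:
  fixes Y :: "'n::finite \<Rightarrow> real ^ 'd"
  assumes min: "\<And>\<phi>'. dual_cost I Y V \<phi> \<le> dual_cost I Y V \<phi>'"
    and inj: "inj_on Y I" and i: "i \<in> I"
  shows "measure \<rho> (laguerre_cell I Y (($) \<phi>) i) \<le> V i"
proof -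
  have fin: "finite I" and I: "I \<noteq> {}" using i by auto
  define A where "A t = {x. \<forall>j\<in>I. j \<noteq> i \<longrightarrow> x \<bullet> Y j - \<phi> $ j + t \<le> x \<bullet> Y i - \<phi> $ i}" for t
  have "A t = (\<Inter>j\<in>I - {i}. {x. x \<bullet> Y j - \<phi> $ j + t \<le> x \<bullet> Y i - \<phi> $ i})" for t
    by (auto simp: A_def)
  moreover have "closed {x. x \<bullet> Y j - \<phi> $ j + t \<le> x \<bullet> Y i - \<phi> $ i}" for j t
    by (intro closed_Collect_le continuous_intros)
  ultimately have "closed (A t)" for t by auto
  then have A_meas: "A t \<in> sets \<rho>" for t
    by (simp add: sets_rho)
  have A_le: "measure \<rho> (A t) \<le> V i" if t: "t > 0" for t
  proof -
    define \<phi>' where "\<phi>' = \<phi> + axis i t"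
    have \<phi>': "\<phi>' $ j = \<phi> $ j + (if j = i then t else 0)" for j
      by (simp add: \<phi>'_def axis_def)
    have "envelope I Y (($) \<phi>') x \<le> envelope I Y (($) \<phi>) x - t * indicator (A t) x" for x
    proof (rule envelope_le[OF fin I])
      fix j assume j: "j \<in> I"
      show "x \<bullet> Y j - \<phi>' $ j \<le> envelope I Y (($) \<phi>) x - t * indicator (A t) x"
        using envelope_ge[OF fin j, of x Y "($) \<phi>"] envelope_ge[OF fin i, of x Y "($) \<phi>"] j t
        by (cases "j = i") (auto simp: \<phi>' A_def indicator_def)
    qed
    then have "(LINT x|\<rho>. envelope I Y (($) \<phi>') x)
        \<le> (LINT x|\<rho>. envelope I Y (($) \<phi>) x - t * indicator (A t) x)"
      using I A_meas by (intro integral_mono) (auto intro!: integrable_real_indicator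
          Bochner_Integration.integrable_diff simp: less_top[symmetric])
    also have "\<dots> = (LINT x|\<rho>. envelope I Y (($) \<phi>) x) - t * measure \<rho> (A t)"
      using I A_meas by (subst Bochner_Integration.integral_diff) (auto intro!: integrable_real_indicator
          simp: less_top[symmetric])
    finally have "(LINT x|\<rho>. envelope I Y (($) \<phi>') x)
        \<le> (LINT x|\<rho>. envelope I Y (($) \<phi>) x) - t * measure \<rho> (A t)" .
    moreover have "(\<Sum>j\<in>I. V j * \<phi>' $ j) = (\<Sum>j\<in>I. V j * \<phi> $ j) + V i * t"
      using i by (simp add: \<phi>' algebra_simps sum.distrib if_distrib[of "(*) _"] sum.delta cong: if_cong)
    ultimately have "t * measure \<rho> (A t) \<le> t * V i"
      using min[of \<phi>'] by (simp add: dual_cost_def mult.commute)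
    then show ?thesis
      using t by simp
  qed
  \<comment> \<open>Leads shrinking to 0: the sets \<open>A (t n)\<close> increase to the cell, up
    to the null set of ties.\<close>
  define t :: "nat \<Rightarrow> real" where "t n = 1 / (real n + 1)" for n
  have "incseq (\<lambda>n. A (t n))"
  proof (rule incseq_SucI)
    fix n
    have "t (Suc n) \<le> t n" by (simp add: t_def frac_le)
    then show "A (t n) \<subseteq> A (t (Suc n))"
      by (force simp: A_def)
  qed
  then have "(\<lambda>n. measure \<rho> (A (t n))) \<longlonglongrightarrow> measure \<rho> (\<Union>n. A (t n))"
    using A_meas by (intro finite_Lim_measure_incseq) auto
  then have "measure \<rho> (\<Union>n. A (t n)) \<le> V i"
    by (rule LIMSEQ_le_const2) (auto intro!: A_le exI[of _ 0] simp: t_def)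
  moreover have "measure \<rho> (laguerre_cell I Y (($) \<phi>) i) = measure \<rho> (\<Union>n. A (t n))"
  proof (rule measure_eq_AE)
    show "AE x in \<rho>. x \<in> laguerre_cell I Y (($) \<phi>) i \<longleftrightarrow> x \<in> (\<Union>n. A (t n))"
      using AE_distinct[OF fin inj, of "($) \<phi>"]
    proof eventually_elim
      case (elim x)
      have t_pos: "0 < t n" for n by (simp add: t_def)
      show ?case
      proof
        assume x: "x \<in> laguerre_cell I Y (($) \<phi>) i"
        define g where "g j = (x \<bullet> Y i - \<phi> $ i) - (x \<bullet> Y j - \<phi> $ j)" for j
        have g: "0 < g j" if "j \<in> I" "j \<noteq> i" for j
          using x elim that i by (fastforce simp: g_def laguerre_cell_def)
        \<comment> \<open>The smallest lead of \<open>i\<close>; inserting 1 keeps the minimum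
          defined when \<open>I = {i}\<close>.\<close>
        define m where "m = Min (insert 1 (g ` (I - {i})))"
        have "0 < m" unfolding m_def using g by (subst Min_gr_iff) auto
        then obtain n where n: "inverse (real (Suc n)) < m"
          using reals_Archimedean by blast
        have "t n \<le> g j" if "j \<in> I" "j \<noteq> i" for j
        proof -
          have "m \<le> g j" unfolding m_def using that by (intro Min_le) auto
          then show ?thesis using n by (simp add: t_def inverse_eq_divide add.commute)
        qed
        then have "x \<in> A (t n)"
          by (force simp: A_def g_def)
        then show "x \<in> (\<Union>n. A (t n))" by auto
      next
        assume "x \<in> (\<Union>n. A (t n))"
        then obtain n where "x \<in> A (t n)" by auto
        then show "x \<in> laguerre_cell I Y (($) \<phi>) i"
          using t_pos[of n] by (force simp: A_def laguerre_cell_def)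
      qed
    qed
  qed (use A_meas in \<open>auto simp: sets_rho\<close>)
  ultimately show ?thesis by simp
qed

text \<open>\<open>I\<close> may be a proper subset of the index type: the tessellation of merged
  generators in \<open>irreducible_normal_C\<close> is obtained this way.\<close>

lemma exists_weights:
  fixes Y :: "'n::finite \<Rightarrow> real ^ 'd"
  assumes "I \<noteq> {}" "inj_on Y I" and V: "\<And>i. i \<in> I \<Longrightarrow> 0 < V i" "(\<Sum>i\<in>I. V i) = 1"
  obtains \<phi> where "\<And>i. i \<in> I \<Longrightarrow> measure \<rho> (laguerre_cell I Y \<phi> i) = V i"
proof -
  obtain \<phi> where min: "\<And>\<phi>'. dual_cost I Y V \<phi> \<le> dual_cost I Y V \<phi>'"
    using dual_cost_minimizer[OF assms(1) V] by blast
  have "measure \<rho> (laguerre_cell I Y (($) \<phi>) i) = V i" if "i \<in> I" for i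
  proof (rule sum_mono_inv[of _ I V])
    show "(\<Sum>i\<in>I. measure \<rho> (laguerre_cell I Y (($) \<phi>) i)) = (\<Sum>i\<in>I. V i)"
      using sum_volumes[OF _ assms(1,2)] V(2) by simp
  qed (use volume_le_of_minimizer[OF min assms(2)] that in auto)
  then show ?thesis by (rule that)
qed

end

section \<open>The set \<open>C\<^sub>N\<close> and its support function\<close>

lemma ext_integral_weighted_diracs:
  assumes cont: "continuous_on UNIV \<psi>" and v: "\<And>i. 0 \<le> v $ i"
  shows "ext_integral (weighted_diracs v B) \<psi> = ereal (\<Sum>i\<in>UNIV. v $ i * \<psi> (B $ i))"
proof -
  have [measurable]: "\<psi> \<in> borel_measurable borel"
    using cont by (rule borel_measurable_continuous_onI)
  have [measurable]: "(\<lambda>i. B $ i) \<in> measurable (point_measure UNIV (\<lambda>i. ennreal (v $ i))) borel"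
    by (simp add: measurable_point_measure_eq1)
  have "integrable (weighted_diracs v B) \<psi>"
    unfolding weighted_diracs_def
    by (subst integrable_distr_eq) (auto intro!: integrable_point_measure_finite)
  moreover have "integral\<^sup>L (weighted_diracs v B) \<psi> = (\<Sum>i\<in>UNIV. v $ i * \<psi> (B $ i))"
    unfolding weighted_diracs_def
    by (subst integral_distr) (auto simp: lebesgue_integral_point_measure_finite v)
  ultimately show ?thesis
    by (simp add: ext_integral_eq_integral)
qed

text \<open>Stated for the extended integral because the larger function will be a convex test
  function that need not be integrable.\<close>

lemma ext_integral_mono_AE:
  assumes "AE x in \<mu>. f x \<le> g x"
  shows "ext_integral \<mu> f \<le> ext_integral \<mu> g"
proof -
  have "(\<integral>\<^sup>+ x. ennreal (f x) \<partial>\<mu>) \<le> (\<integral>\<^sup>+ x. ennreal (g x) \<partial>\<mu>)"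
    using assms by (intro nn_integral_mono_AE) (auto elim!: eventually_mono intro: ennreal_leI)
  moreover have "(\<integral>\<^sup>+ x. ennreal (- g x) \<partial>\<mu>) \<le> (\<integral>\<^sup>+ x. ennreal (- f x) \<partial>\<mu>)"
    using assms by (intro nn_integral_mono_AE) (auto elim!: eventually_mono intro: ennreal_leI)
  ultimately show ?thesis
    unfolding ext_integral_def by (intro ereal_minus_mono) (simp_all add: less_eq_ennreal.rep_eq)
qed

locale laguerre_data = ac_P1 \<rho> for \<rho> :: "(real ^ 'd) measure" +
  fixes v :: "real ^ 'n"
  assumes v_pos: "\<And>i. v $ i > 0" and v_sum: "(\<Sum>i\<in>UNIV. v $ i) = 1"
begin

lemma C_N_iff:
  "B \<in> C_N v \<rho> \<longleftrightarrow>
     (\<forall>\<psi>. convex_on UNIV \<psi> \<longrightarrow> ereal (\<Sum>i\<in>UNIV. v $ i * \<psi> (B $ i)) \<le> ext_integral \<rho> \<psi>)"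
proof -
  have "ext_integral (weighted_diracs v B) \<psi> = ereal (\<Sum>i\<in>UNIV. v $ i * \<psi> (B $ i))"
    if "convex_on UNIV \<psi>" for \<psi>
    using that v_pos by (intro ext_integral_weighted_diracs convex_on_continuous) (auto intro: less_imp_le)
  then show ?thesis
    by (auto simp: C_N_def convex_order_def)
qed

lemma C_N_integral_le:
  assumes "B \<in> C_N v \<rho>" "convex_on UNIV \<psi>" "integrable \<rho> \<psi>"
  shows "(\<Sum>i\<in>UNIV. v $ i * \<psi> (B $ i)) \<le> integral\<^sup>L \<rho> \<psi>"
  using assms by (auto simp: C_N_iff ext_integral_eq_integral)

text \<open>Each convex test function is continuous, hence contributes a closed condition on
  \<open>B\<close>.\<close>

lemma closed_C_N: "closed (C_N v \<rho>)"
proof -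
  have eq: "C_N v \<rho> = (\<Inter>\<psi>\<in>{\<psi>. convex_on UNIV \<psi>}.
      {B. ereal (\<Sum>i\<in>UNIV. v $ i * \<psi> (B $ i)) \<le> ext_integral \<rho> \<psi>})"
    by (auto simp: C_N_iff)
  have "closed {B::(real ^ 'd) ^ 'n. ereal (\<Sum>i\<in>UNIV. v $ i * \<psi> (B $ i)) \<le> ext_integral \<rho> \<psi>}"
    if "convex_on UNIV \<psi>" for \<psi> :: "real ^ 'd \<Rightarrow> real"
  proof -
    have "continuous_on UNIV \<psi>"
      using that by (intro convex_on_continuous) auto
    then have "continuous_on UNIV (\<lambda>B::(real ^ 'd) ^ 'n. \<psi> (B $ i))" for i
      by (rule continuous_on_compose2) (auto intro!: continuous_intros)
    then show ?thesis
      by (intro closed_Collect_le continuous_on_ereal continuous_intros)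
  qed
  then show ?thesis
    unfolding eq by auto
qed

lemma convex_C_N: "convex (C_N v \<rho>)"
proof (rule convexI)
  fix A B :: "(real ^ 'd) ^ 'n" and s t :: real
  assume AB: "A \<in> C_N v \<rho>" "B \<in> C_N v \<rho>" and st: "0 \<le> s" "0 \<le> t" "s + t = 1"
  show "s *\<^sub>R A + t *\<^sub>R B \<in> C_N v \<rho>"
    unfolding C_N_iff
  proof (intro allI impI)
    fix \<psi> :: "real ^ 'd \<Rightarrow> real" assume \<psi>: "convex_on UNIV \<psi>"
    define F where "F X = (\<Sum>i\<in>UNIV. v $ i * \<psi> (X $ i))" for X
    have "F (s *\<^sub>R A + t *\<^sub>R B) \<le> (\<Sum>i\<in>UNIV. v $ i * (s * \<psi> (A $ i) + t * \<psi> (B $ i)))"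
      unfolding F_def using \<psi> st v_pos
      by (intro sum_mono mult_left_mono) (auto simp: convex_on_def intro: less_imp_le)
    also have "\<dots> = s * F A + t * F B"
      by (simp add: F_def sum_distrib_left algebra_simps sum.distrib)
    \<comment> \<open>Passing to the maximum keeps the comparison free of products with a possibly
      infinite integral.\<close>
    also have "\<dots> \<le> max (F A) (F B)"
      using st by (intro convex_bound_le) auto
    finally have "ereal (F (s *\<^sub>R A + t *\<^sub>R B)) \<le> max (ereal (F A)) (ereal (F B))"
      by (simp add: max_def split: if_splits)
    also have "\<dots> \<le> ext_integral \<rho> \<psi>"
      using AB \<psi> by (auto simp: C_N_iff F_def)
    finally show "ereal (\<Sum>i\<in>UNIV. v $ i * \<psi> ((s *\<^sub>R A + t *\<^sub>R B) $ i)) \<le> ext_integral \<rho> \<psi>"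
      by (simp add: F_def)
  qed
qed

text \<open>Linear functions and their negatives are both convex.\<close>

lemma C_N_mean:
  assumes "B \<in> C_N v \<rho>"
  shows "(\<Sum>i\<in>UNIV. v $ i * (B $ i \<bullet> a)) = (LINT x|\<rho>. x \<bullet> a)"
proof -
  have le: "(\<Sum>i\<in>UNIV. v $ i * (B $ i \<bullet> a)) \<le> (LINT x|\<rho>. x \<bullet> a)" for a
    using assms by (intro C_N_integral_le) (auto simp: convex_on_def inner_add_left)
  from le[of a] le[of "- a"] show ?thesis
    by (simp add: sum_negf)
qed

section \<open>Fractional partitions and duality\<close>

text \<open>A transport plan from \<open>\<rho>\<close> to the indices: \<open>q i x\<close> is the
  share of the mass at \<open>x\<close> sent to \<open>i\<close>. Fractional shares allow a cell to
  be split among merged indices; the sum is 1 only almost everywhere because closed cells overlap on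
  null sets.\<close>

definition fractional_partition :: "('n \<Rightarrow> real ^ 'd \<Rightarrow> real) \<Rightarrow> (real ^ 'd) ^ 'n \<Rightarrow> bool" where
  "fractional_partition q B \<longleftrightarrow>
     (\<forall>i. q i \<in> borel_measurable borel) \<and> (\<forall>i x. 0 \<le> q i x \<and> q i x \<le> 1) \<and>
     (AE x in \<rho>. (\<Sum>i\<in>UNIV. q i x) = 1) \<and>
     (\<forall>i. (LINT x|\<rho>. q i x) = v $ i) \<and>
     (\<forall>i. (LINT x|\<rho>. q i x *\<^sub>R x) = v $ i *\<^sub>R B $ i)"

lemma fractional_partition_integrable:
  assumes "fractional_partition q B"
  shows "integrable \<rho> (q i)" "integrable \<rho> (\<lambda>x. q i x *\<^sub>R x)" "integrable \<rho> (\<lambda>x. q i x * (x \<bullet> a))"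
proof -
  have [measurable]: "q i \<in> borel_measurable borel" and q: "\<And>x. 0 \<le> q i x" "\<And>x. q i x \<le> 1"
    using assms by (auto simp: fractional_partition_def)
  show "integrable \<rho> (q i)"
    using q by (intro integrable_const_bound[of _ 1]) auto
  show 1: "integrable \<rho> (\<lambda>x. q i x *\<^sub>R x)"
    using q by (intro Bochner_Integration.integrable_bound[OF integrable_rho_id])
      (auto intro!: mult_left_le_one_le)
  have "integrable \<rho> (\<lambda>x. (q i x *\<^sub>R x) \<bullet> a)"
    using 1 by (intro integrable_inner_left) auto
  then show "integrable \<rho> (\<lambda>x. q i x * (x \<bullet> a))" by simp
qed

text \<open>The integral is linear in \<open>q\<close>, so only masses and first moments enter. It
  is applied to generators, to perturbation directions and to supporting affine functions.\<close>

lemma fractional_partition_pairing: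
  assumes q: "fractional_partition q B"
  shows "integrable \<rho> (\<lambda>x. \<Sum>i\<in>UNIV. q i x * (x \<bullet> Z $ i - \<phi> i))"
    and "(LINT x|\<rho>. (\<Sum>i\<in>UNIV. q i x * (x \<bullet> Z $ i - \<phi> i)))
           = inner_v v B Z - (\<Sum>i\<in>UNIV. v $ i * \<phi> i)"
proof -
  note int = fractional_partition_integrable[OF q]
  have int2: "integrable \<rho> (\<lambda>x. q i x * (x \<bullet> Z $ i - \<phi> i))" for i
    using int by (simp add: right_diff_distrib)
  then show "integrable \<rho> (\<lambda>x. \<Sum>i\<in>UNIV. q i x * (x \<bullet> Z $ i - \<phi> i))" by simp
  have "(LINT x|\<rho>. q i x * (x \<bullet> Z $ i - \<phi> i)) = v $ i * (B $ i \<bullet> Z $ i) - v $ i * \<phi> i" for i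
  proof -
    have "(LINT x|\<rho>. (q i x *\<^sub>R x) \<bullet> Z $ i) = (LINT x|\<rho>. q i x *\<^sub>R x) \<bullet> Z $ i"
      using int by (intro integral_inner_left) auto
    then have "(LINT x|\<rho>. q i x * (x \<bullet> Z $ i)) = v $ i * (B $ i \<bullet> Z $ i)"
      using q by (simp add: fractional_partition_def)
    then show ?thesis
      using int q by (simp add: right_diff_distrib fractional_partition_def)
  qed
  then show "(LINT x|\<rho>. (\<Sum>i\<in>UNIV. q i x * (x \<bullet> Z $ i - \<phi> i)))
           = inner_v v B Z - (\<Sum>i\<in>UNIV. v $ i * \<phi> i)"
    using int2 by (simp add: inner_v_def sum_subtractf)
qed

text \<open>Jensen's inequality: averaging with shares \<open>q i x\<close> the supporting affine
  functions of \<open>\<psi>\<close> at the points \<open>B $ i\<close> stays below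
  \<open>\<psi>\<close>, and the average integrates to the discrete sum.\<close>

lemma fractional_partition_C_N:
  assumes q: "fractional_partition q B"
  shows "B \<in> C_N v \<rho>"
  unfolding C_N_iff
proof (intro allI impI)
  fix \<psi> :: "real ^ 'd \<Rightarrow> real" assume \<psi>: "convex_on UNIV \<psi>"
  have "\<exists>a. \<forall>x. \<psi> (B $ i) + a \<bullet> (x - B $ i) \<le> \<psi> x" for i
    using convex_on_supporting_affine[OF \<psi>] by metis
  then obtain a where a: "\<And>i x. \<psi> (B $ i) + a i \<bullet> (x - B $ i) \<le> \<psi> x" by metis
  \<comment> \<open>The supporting function at \<open>B $ i\<close> is written as
    \<open>x \<bullet> Z $ i - c i\<close>, the form required by the pairing.\<close>
  define Z where "Z = (\<chi> i. a i)"
  define c where "c i = a i \<bullet> B $ i - \<psi> (B $ i)" for i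
  let ?g = "\<lambda>x. \<Sum>i\<in>UNIV. q i x * (x \<bullet> Z $ i - c i)"
  note pairing = fractional_partition_pairing[OF q, of Z c]
  have "(\<Sum>i\<in>UNIV. v $ i * \<psi> (B $ i)) = inner_v v B Z - (\<Sum>i\<in>UNIV. v $ i * c i)"
    by (simp add: inner_v_def Z_def c_def inner_commute algebra_simps sum_subtractf sum.distrib)
  also have "\<dots> = integral\<^sup>L \<rho> ?g"
    using pairing(2) by simp
  also have "ereal \<dots> = ext_integral \<rho> ?g"
    using pairing(1) by (simp add: ext_integral_eq_integral)
  also have "\<dots> \<le> ext_integral \<rho> \<psi>"
  proof (rule ext_integral_mono_AE)
    have "AE x in \<rho>. (\<Sum>i\<in>UNIV. q i x) = 1"
      using q by (simp add: fractional_partition_def)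
    then show "AE x in \<rho>. ?g x \<le> \<psi> x"
    proof eventually_elim
      case (elim x)
      have "?g x \<le> (\<Sum>i\<in>UNIV. q i x * \<psi> x)"
      proof (intro sum_mono mult_left_mono)
        fix i
        show "x \<bullet> Z $ i - c i \<le> \<psi> x"
          using a[of i x] by (simp add: Z_def c_def inner_commute inner_diff_right)
        show "0 \<le> q i x"
          using q by (simp add: fractional_partition_def)
      qed
      also have "\<dots> = \<psi> x"
        using elim by (simp flip: sum_distrib_right)
      finally show ?case .
    qed
  qed
  finally show "ereal (\<Sum>i\<in>UNIV. v $ i * \<psi> (B $ i)) \<le> ext_integral \<rho> \<psi>" .
qed

text \<open>Weak duality: each affine piece is below the envelope at \<open>B $ i\<close>, and the
  envelope is a convex test function.\<close>

lemma inner_v_le_envelope: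
  assumes "B \<in> C_N v \<rho>"
  shows "inner_v v B Y \<le> (LINT x|\<rho>. envelope UNIV (($) Y) \<phi> x) + (\<Sum>i\<in>UNIV. v $ i * \<phi> i)"
proof -
  have "inner_v v B Y - (\<Sum>i\<in>UNIV. v $ i * \<phi> i) = (\<Sum>i\<in>UNIV. v $ i * (B $ i \<bullet> Y $ i - \<phi> i))"
    by (simp add: inner_v_def right_diff_distrib sum_subtractf)
  also have "\<dots> \<le> (\<Sum>i\<in>UNIV. v $ i * envelope UNIV (($) Y) \<phi> (B $ i))"
    using v_pos by (intro sum_mono mult_left_mono envelope_ge) (auto intro: less_imp_le)
  also have "\<dots> \<le> (LINT x|\<rho>. envelope UNIV (($) Y) \<phi> x)"
    using assms by (intro C_N_integral_le convex_on_envelope) auto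
  finally show ?thesis by simp
qed

text \<open>Complementary slackness: equality holds when mass goes only to indices attaining the
  envelope. \<open>Y\<close> may have repeated entries, which is what makes this applicable to
  vectors in \<open>Delta\<close>.\<close>

lemma fractional_partition_optimal:
  assumes q: "fractional_partition q B"
    and opt: "AE x in \<rho>. \<forall>i. q i x \<noteq> 0 \<longrightarrow> envelope UNIV (($) Y) \<phi> x = x \<bullet> Y $ i - \<phi> i"
  shows "inner_v v B Y = (LINT x|\<rho>. envelope UNIV (($) Y) \<phi> x) + (\<Sum>i\<in>UNIV. v $ i * \<phi> i)"
proof -
  have "AE x in \<rho>. (\<Sum>i\<in>UNIV. q i x) = 1"
    using q by (simp add: fractional_partition_def)
  with opt have "AE x in \<rho>. (\<Sum>i\<in>UNIV. q i x * (x \<bullet> Y $ i - \<phi> i)) = envelope UNIV (($) Y) \<phi> x"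
  proof eventually_elim
    case (elim x)
    have "(\<Sum>i\<in>UNIV. q i x * (x \<bullet> Y $ i - \<phi> i)) = (\<Sum>i\<in>UNIV. q i x * envelope UNIV (($) Y) \<phi> x)"
      using elim(1) by (intro sum.cong) auto
    then show ?case
      using elim(2) by (simp flip: sum_distrib_right)
  qed
  then have "(LINT x|\<rho>. (\<Sum>i\<in>UNIV. q i x * (x \<bullet> Y $ i - \<phi> i)))
      = (LINT x|\<rho>. envelope UNIV (($) Y) \<phi> x)"
    using fractional_partition_pairing(1)[OF q, of Y \<phi>]
    by (intro integral_cong_AE) auto
  then show ?thesis
    using fractional_partition_pairing(2)[OF q, of Y \<phi>] by simp
qed

lemma fractional_partition_cells:
  assumes "inj Y" "has_volumes \<rho> v (laguerre_cell UNIV Y \<phi>)"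
    and "has_barycenters \<rho> v (laguerre_cell UNIV Y \<phi>) B"
  shows "fractional_partition (\<lambda>i. indicator (laguerre_cell UNIV Y \<phi> i)) B"
  using assms v_pos AE_sum_indicator_cells[of UNIV Y \<phi>]
  by (auto simp: fractional_partition_def has_volumes_def has_barycenters_def
      set_lebesgue_integral_def less_imp_neq[symmetric])

section \<open>Normal cones and irreducibility\<close>

text \<open>The normal cone with respect to \<open>inner_v\<close>; membership of \<open>P\<close>
  in \<open>C_N\<close> is assumed separately where it is needed.\<close>

definition normal_C :: "(real ^ 'd) ^ 'n \<Rightarrow> ((real ^ 'd) ^ 'n) set" where
  "normal_C P = {Y. \<forall>Q\<in>C_N v \<rho>. inner_v v Q Y \<le> inner_v v P Y}"

lemma cells_optimal:
  assumes "inj (($) Y)" "has_volumes \<rho> v (laguerre_cell UNIV (($) Y) \<phi>)"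
    and "has_barycenters \<rho> v (laguerre_cell UNIV (($) Y) \<phi>) B"
  shows "inner_v v B Y = (LINT x|\<rho>. envelope UNIV (($) Y) \<phi> x) + (\<Sum>i\<in>UNIV. v $ i * \<phi> i)"
  using assms
  by (intro fractional_partition_optimal[OF fractional_partition_cells])
     (auto simp: mem_laguerre_cell_iff indicator_def)

lemma exists_volumes:
  assumes "inj (($) Y)"
  obtains \<phi> where "has_volumes \<rho> v (laguerre_cell UNIV (($) (Y :: (real ^ 'd) ^ 'n)) \<phi>)"
  using exists_weights[of UNIV "($) Y" "($) v"] assms v_pos v_sum
  by (auto simp: has_volumes_def)

text \<open>Uniqueness of the maximizer: the dual bound is differentiable at generators without
  repetitions, and \<open>P\<close> attains it.\<close>

lemma barycenters_of_normal:
  assumes P: "P \<in> C_N v \<rho>" "Y \<in> normal_C P" and inj: "inj (($) Y)"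
    and vol: "has_volumes \<rho> v (laguerre_cell UNIV (($) Y) \<phi>)"
  shows "has_barycenters \<rho> v (laguerre_cell UNIV (($) Y) \<phi>) P"
proof -
  let ?L = "laguerre_cell UNIV (($) Y) \<phi>"
  define B where "B = (\<chi> i. (1 / v $ i) *\<^sub>R (LINT x:?L i|\<rho>. x))"
  have B: "has_barycenters \<rho> v ?L B"
    by (simp add: has_barycenters_def B_def)
  have frac: "fractional_partition (\<lambda>i. indicator (?L i)) B"
    using inj vol B by (rule fractional_partition_cells)
  \<comment> \<open>The barycenters \<open>B\<close> attain the dual bound, and \<open>P\<close>
    does at least as well as \<open>B\<close>.\<close>
  have PY: "inner_v v P Y = (LINT x|\<rho>. envelope UNIV (($) Y) \<phi> x) + (\<Sum>i\<in>UNIV. v $ i * \<phi> i)"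
  proof (rule antisym)
    have "inner_v v B Y \<le> inner_v v P Y"
      using P(2) fractional_partition_C_N[OF frac] by (simp add: normal_C_def)
    then show "(LINT x|\<rho>. envelope UNIV (($) Y) \<phi> x) + (\<Sum>i\<in>UNIV. v $ i * \<phi> i) \<le> inner_v v P Y"
      using cells_optimal[OF inj vol B] by simp
  qed (rule inner_v_le_envelope[OF P(1)])
  text \<open>Optimality of \<open>P\<close> along \<open>Y + \<epsilon>H\<close> gives \<open>\<langle>P, H\<rangle>\<^sub>v \<le> \<langle>B, H\<rangle>\<^sub>v\<close> in the limit, since the
    envelope has derivative \<open>\<langle>x, h\<^sub>i\<rangle>\<close> in the interior of cell \<open>i\<close>; then \<open>H = P - B\<close> gives \<open>P = B\<close>.\<close>
  define H where "H = P - B"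
  define e :: "nat \<Rightarrow> real" where "e n = inverse (real (Suc n))" for n
  have e: "0 < e n" for n by (simp add: e_def)
  have e_lim: "e \<longlonglongrightarrow> 0"
    unfolding e_def by (rule LIMSEQ_inverse_real_of_nat)
  define D where "D n x = (envelope UNIV (($) (Y + e n *\<^sub>R H)) \<phi> x - envelope UNIV (($) Y) \<phi> x) / e n"
    for n x
  have int_D: "integrable \<rho> (D n)" for n
    unfolding D_def[abs_def] by auto
  have le: "inner_v v P H \<le> integral\<^sup>L \<rho> (D n)" for n
  proof -
    have "inner_v v P (Y + e n *\<^sub>R H) = inner_v v P Y + e n * inner_v v P H"
      by (simp add: inner_v_def inner_add_right algebra_simps sum.distrib sum_distrib_left)
    then have "e n * inner_v v P H \<le> (LINT x|\<rho>. envelope UNIV (($) (Y + e n *\<^sub>R H)) \<phi> x)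
        - (LINT x|\<rho>. envelope UNIV (($) Y) \<phi> x)"
      using inner_v_le_envelope[OF P(1), of "Y + e n *\<^sub>R H" \<phi>] PY by simp
    also have "\<dots> = integral\<^sup>L \<rho> (\<lambda>x. e n * D n x)"
      unfolding D_def using e[of n] by (simp add: less_imp_neq[symmetric])
    also have "\<dots> = e n * integral\<^sup>L \<rho> (D n)" by simp
    finally show ?thesis using e[of n] by simp
  qed
  \<comment> \<open>Almost everywhere limit of the difference quotients. The term \<open>- 0\<close>
    matches \<open>fractional_partition_pairing\<close> with zero weights.\<close>
  define G where "G x = (\<Sum>i\<in>UNIV. indicator (?L i) x * (x \<bullet> H $ i - 0))" for x
  have "(\<lambda>n. integral\<^sup>L \<rho> (D n)) \<longlonglongrightarrow> integral\<^sup>L \<rho> G"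
  proof (rule integral_dominated_convergence[where w = "\<lambda>x. \<Sum>i\<in>UNIV. \<bar>x \<bullet> H $ i\<bar>"])
    show "G \<in> borel_measurable \<rho>" "\<And>n. D n \<in> borel_measurable \<rho>"
      using int_D fractional_partition_pairing(1)[OF frac, of H "\<lambda>_. 0"]
      by (auto simp: G_def[abs_def])
    show "integrable \<rho> (\<lambda>x. \<Sum>i\<in>UNIV. \<bar>x \<bullet> H $ i\<bar>)"
      by (auto intro!: integrable_abs integrable_inner_left)
    show "AE x in \<rho>. norm (D n x) \<le> (\<Sum>i\<in>UNIV. \<bar>x \<bullet> H $ i\<bar>)" for n
    proof (intro AE_I2)
      fix x
      \<comment> \<open>At fixed \<open>x\<close> the envelope changes by at most
        \<open>e n * s\<close> when the generators move by \<open>e n *\<^sub>R H\<close>, which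
        bounds the quotients uniformly in \<open>n\<close>.\<close>
      define s where "s = (\<Sum>i\<in>UNIV. \<bar>x \<bullet> H $ i\<bar>)"
      have s: "\<bar>x \<bullet> H $ i\<bar> \<le> s" for i
        unfolding s_def by (intro member_le_sum) auto
      have es: "\<bar>e n * (x \<bullet> H $ i)\<bar> \<le> e n * s" for i
        using s[of i] e[of n] by (simp add: abs_mult)
      have "envelope UNIV (($) (Y + e n *\<^sub>R H)) \<phi> x \<le> envelope UNIV (($) Y) \<phi> x + e n * s"
      proof (rule envelope_le)
        fix i
        show "x \<bullet> (Y + e n *\<^sub>R H) $ i - \<phi> i \<le> envelope UNIV (($) Y) \<phi> x + e n * s"
          using es[of i] envelope_ge[of UNIV i x "($) Y" \<phi>] by (simp add: inner_add_right)
      qed auto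
      moreover have "envelope UNIV (($) Y) \<phi> x \<le> envelope UNIV (($) (Y + e n *\<^sub>R H)) \<phi> x + e n * s"
      proof (rule envelope_le)
        fix i
        show "x \<bullet> Y $ i - \<phi> i \<le> envelope UNIV (($) (Y + e n *\<^sub>R H)) \<phi> x + e n * s"
          using es[of i] envelope_ge[of UNIV i x "($) (Y + e n *\<^sub>R H)" \<phi>]
          by (simp add: inner_add_right)
      qed auto
      ultimately show "norm (D n x) \<le> (\<Sum>i\<in>UNIV. \<bar>x \<bullet> H $ i\<bar>)"
        using e[of n] unfolding D_def s_def[symmetric] by (simp add: abs_le_iff field_simps)
    qed
    show "AE x in \<rho>. (\<lambda>n. D n x) \<longlonglongrightarrow> G x"
      using AE_unique_cell[OF finite UNIV_not_empty inj, of \<phi>] AE_distinct[OF finite inj, of \<phi>]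
    proof eventually_elim
      case (elim x)
      then obtain i where i: "\<And>j. x \<in> ?L j \<longleftrightarrow> j = i" by auto
      have "G x = (\<Sum>j\<in>UNIV. if j = i then x \<bullet> H $ i else 0)"
        unfolding G_def by (intro sum.cong) (auto simp: i indicator_def)
      then have G: "G x = x \<bullet> H $ i" by simp
      \<comment> \<open>Off the ties index \<open>i\<close> leads strictly, hence still leads for
        small perturbations; the quotient is then eventually constant.\<close>
      have "\<forall>\<^sub>F n in sequentially. x \<bullet> (Y + e n *\<^sub>R H) $ j - \<phi> j \<le> x \<bullet> (Y + e n *\<^sub>R H) $ i - \<phi> i" for j
      proof (cases "j = i")
        case False
        have "x \<in> ?L i" using i by simp
        then have "x \<bullet> Y $ j - \<phi> j < x \<bullet> Y $ i - \<phi> i"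
          using False elim(2) by (force simp: laguerre_cell_def)
        moreover have "(\<lambda>n. (x \<bullet> Y $ i - \<phi> i + e n * (x \<bullet> H $ i)) - (x \<bullet> Y $ j - \<phi> j + e n * (x \<bullet> H $ j)))
            \<longlonglongrightarrow> (x \<bullet> Y $ i - \<phi> i + 0 * (x \<bullet> H $ i)) - (x \<bullet> Y $ j - \<phi> j + 0 * (x \<bullet> H $ j))"
          by (intro tendsto_intros e_lim)
        ultimately have "\<forall>\<^sub>F n in sequentially.
            0 < (x \<bullet> Y $ i - \<phi> i + e n * (x \<bullet> H $ i)) - (x \<bullet> Y $ j - \<phi> j + e n * (x \<bullet> H $ j))"
          by (intro order_tendstoD) auto
        then show ?thesis
          by eventually_elim (simp add: inner_add_right)
      qed simp
      then have "\<forall>\<^sub>F n in sequentially. \<forall>j. x \<bullet> (Y + e n *\<^sub>R H) $ j - \<phi> j \<le> x \<bullet> (Y + e n *\<^sub>R H) $ i - \<phi> i"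
        by (simp add: eventually_all_finite)
      then have "\<forall>\<^sub>F n in sequentially. D n x = G x"
      proof eventually_elim
        case (elim n)
        have "x \<in> laguerre_cell UNIV (($) (Y + e n *\<^sub>R H)) \<phi> i"
          using elim by (simp add: laguerre_cell_def)
        then have "envelope UNIV (($) (Y + e n *\<^sub>R H)) \<phi> x = x \<bullet> (Y + e n *\<^sub>R H) $ i - \<phi> i"
          by (subst (asm) mem_laguerre_cell_iff) auto
        moreover have "envelope UNIV (($) Y) \<phi> x = x \<bullet> Y $ i - \<phi> i"
          using i[of i] by (subst (asm) mem_laguerre_cell_iff) auto
        ultimately show ?case
          using e[of n] G by (simp add: D_def inner_add_right)
      qed
      then show ?case
        by (rule tendsto_eventually)
    qed
  qed
  then have "inner_v v P H \<le> integral\<^sup>L \<rho> G"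
    by (rule LIMSEQ_le_const) (use le in auto)
  also have "\<dots> = inner_v v B H"
    unfolding G_def by (subst fractional_partition_pairing(2)[OF frac]) simp
  finally have "(\<Sum>i\<in>UNIV. v $ i * (H $ i \<bullet> H $ i)) \<le> 0"
    by (simp add: inner_v_def H_def inner_diff_left right_diff_distrib sum_subtractf)
  moreover have "0 \<le> v $ i * (H $ i \<bullet> H $ i)" for i
    using v_pos[of i] by simp
  ultimately have "v $ i * (H $ i \<bullet> H $ i) = 0" for i
    by (metis (mono_tags, lifting) UNIV_I finite_code sum_nonneg sum_nonneg_eq_0_iff order.antisym)
  then have "H $ i = 0" for i
    using v_pos[of i] by (metis inner_eq_zero_iff less_irrefl mult_eq_0_iff)
  then have "P = B"
    by (simp add: H_def vec_eq_iff)
  then show ?thesis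
    using B by simp
qed

text \<open>If \<open>Y\<close> had repeated but not all equal entries, its distinct values would
  generate a tessellation with fewer, yet at least two, cells, each a union of the given cells. This
  contradicts irreducibility.\<close>

lemma irreducible_normal_C:
  assumes irr: "irreducible_laguerre \<rho> (laguerre_cell UNIV g \<phi>)" and inj: "inj g"
    and vol: "has_volumes \<rho> v (laguerre_cell UNIV g \<phi>)"
    and bar: "has_barycenters \<rho> v (laguerre_cell UNIV g \<phi>) B"
    and Y: "Y \<in> normal_C B" "Y \<in> Delta"
  shows "Y $ i = Y $ j"
proof (rule ccontr)
  assume neq: "Y $ i \<noteq> Y $ j"
  let ?L = "laguerre_cell UNIV g \<phi>"
  have frac: "fractional_partition (\<lambda>i. indicator (?L i)) B"
    using inj vol bar by (rule fractional_partition_cells)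
  \<comment> \<open>\<open>r\<close> selects one representative index per value of \<open>Y\<close>;
    \<open>I\<close> collects them, and \<open>V\<close> below adds up the volumes of a
    class.\<close>
  define r where "r k = (SOME l. Y $ l = Y $ k)" for k
  have Yr [simp]: "Y $ r k = Y $ k" for k
    unfolding r_def by (rule someI[of _ k]) simp
  have r_eq: "r k = r l \<longleftrightarrow> Y $ k = Y $ l" for k l
    by (metis Yr r_def)
  define I where "I = range r"
  have I: "I \<noteq> {}" "finite I" by (auto simp: I_def)
  have inj_I: "inj_on (($) Y) I"
    by (auto simp: inj_on_def I_def r_eq)
  have r_I: "r k = k" if "k \<in> I" for k
    using that by (auto simp: I_def r_eq)
  define V where "V k = (\<Sum>l | r l = k. v $ l)" for k
  have V_pos: "0 < V k" if "k \<in> I" for k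
    unfolding V_def using v_pos r_I[OF that] by (intro sum_pos) auto
  have V_sum: "(\<Sum>k\<in>I. V k) = 1"
    unfolding V_def I_def using v_sum sum.image_gen[of UNIV "($) v" r] by simp
  obtain \<psi> where \<psi>: "\<And>k. k \<in> I \<Longrightarrow> measure \<rho> (laguerre_cell I (($) Y) \<psi> k) = V k"
    using exists_weights[OF I(1) inj_I V_pos V_sum] by metis
  \<comment> \<open>Extending the weights constantly over each class makes the envelope over all
    indices equal to the coarse one.\<close>
  define \<psi>' where "\<psi>' k = \<psi> (r k)" for k
  have "(\<lambda>k. x \<bullet> Y $ k - \<psi>' k) ` UNIV = (\<lambda>k. x \<bullet> Y $ k - \<psi> k) ` I" for x
    unfolding \<psi>'_def I_def image_image Yr ..
  then have env: "envelope UNIV (($) Y) \<psi>' x = envelope I (($) Y) \<psi> x" for x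
    by (simp add: envelope_def)
  have in_I: "r k \<in> I" for k by (simp add: I_def)
  have mem: "x \<in> laguerre_cell I (($) Y) \<psi> (r k) \<longleftrightarrow> envelope UNIV (($) Y) \<psi>' x = x \<bullet> Y $ k - \<psi>' k" for x k
    using I in_I by (simp add: mem_laguerre_cell_iff env \<psi>'_def)
  text \<open>Splitting each cell of the coarse tessellation proportionally gives a competitor in
    \<open>C_N\<close>; so maximality of \<open>B\<close> in direction \<open>Y\<close> forces the merged cells to be the coarse ones.\<close>
  define q where "q k x = (v $ k / V (r k)) * indicator (laguerre_cell I (($) Y) \<psi> (r k)) x" for k x
  define B' where "B' = (\<chi> k. (1 / v $ k) *\<^sub>R (LINT x|\<rho>. q k x *\<^sub>R x))"
  have "v $ k \<le> V (r k)" for k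
    unfolding V_def using v_pos by (intro member_le_sum) (auto intro: less_imp_le)
  then have ratio: "0 \<le> v $ k / V (r k)" "v $ k / V (r k) \<le> 1" for k
    using v_pos[of k] V_pos[OF in_I[of k]] by auto
  have frac': "fractional_partition q B'"
    unfolding fractional_partition_def
  proof (intro conjI allI)
    fix k
    show "q k \<in> borel_measurable borel"
      unfolding q_def[abs_def] by measurable
    show "0 \<le> q k x" "q k x \<le> 1" for x
      using ratio[of k] by (auto simp: q_def indicator_def)
    show "(LINT x|\<rho>. q k x) = v $ k"
      using \<psi>[OF in_I[of k]] V_pos[OF in_I[of k]] by (simp add: q_def)
    show "(LINT x|\<rho>. q k x *\<^sub>R x) = v $ k *\<^sub>R B' $ k"
      using v_pos[of k] by (simp add: B'_def)
  next
    show "AE x in \<rho>. (\<Sum>k\<in>UNIV. q k x) = 1"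
      using AE_sum_indicator_cells[OF I(2,1) inj_I, of \<psi>]
    proof eventually_elim
      case (elim x)
      have "(\<Sum>k\<in>UNIV. q k x) = (\<Sum>k\<in>I. \<Sum>l | r l = k. q l x)"
        unfolding I_def using sum.image_gen[of UNIV "\<lambda>k. q k x" r] by simp
      also have "\<dots> = (\<Sum>k\<in>I. \<Sum>l | r l = k. v $ l * (indicator (laguerre_cell I (($) Y) \<psi> k) x / V k))"
        by (intro sum.cong) (auto simp: q_def)
      also have "\<dots> = (\<Sum>k\<in>I. V k * (indicator (laguerre_cell I (($) Y) \<psi> k) x / V k))"
        by (intro sum.cong refl) (simp only: V_def sum_distrib_right)
      also have "\<dots> = (\<Sum>k\<in>I. indicator (laguerre_cell I (($) Y) \<psi> k) x)"
        using V_pos by (intro sum.cong) (auto simp: less_imp_neq[symmetric])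
      finally show ?case using elim by simp
    qed
  qed
  have "inner_v v B' Y = (LINT x|\<rho>. envelope UNIV (($) Y) \<psi>' x) + (\<Sum>k\<in>UNIV. v $ k * \<psi>' k)"
    using frac' by (rule fractional_partition_optimal) (auto simp: q_def mem indicator_def)
  moreover have "inner_v v B' Y \<le> inner_v v B Y"
    using Y(1) fractional_partition_C_N[OF frac'] by (simp add: normal_C_def)
  \<comment> \<open>The affine function selected by the fine cell of \<open>x\<close>. It lies below
    the coarse envelope but has at least the same integral, so the two agree almost
    everywhere.\<close>
  moreover define G where "G x = (\<Sum>k\<in>UNIV. indicator (?L k) x * (x \<bullet> Y $ k - \<psi>' k))" for x
  ultimately have G_int: "integrable \<rho> G" "(LINT x|\<rho>. envelope UNIV (($) Y) \<psi>' x) \<le> integral\<^sup>L \<rho> G"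
    using fractional_partition_pairing[OF frac, of Y \<psi>'] by (auto simp: G_def[abs_def])
  have AE_cell: "AE x in \<rho>. \<exists>k\<in>UNIV. \<forall>l\<in>UNIV. x \<in> ?L l \<longleftrightarrow> l = k"
    using AE_unique_cell[of UNIV g \<phi>] inj by simp
  have G_eq: "G x = x \<bullet> Y $ k - \<psi>' k" if "\<forall>l\<in>UNIV. x \<in> ?L l \<longleftrightarrow> l = k" for x k
  proof -
    have "G x = (\<Sum>l\<in>UNIV. if l = k then x \<bullet> Y $ k - \<psi>' k else 0)"
      unfolding G_def using that by (intro sum.cong) (auto simp: indicator_def)
    then show ?thesis by simp
  qed
  have nonneg: "AE x in \<rho>. 0 \<le> envelope UNIV (($) Y) \<psi>' x - G x"
    using AE_cell
  proof eventually_elim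
    case (elim x)
    then obtain k where "\<forall>l\<in>UNIV. x \<in> ?L l \<longleftrightarrow> l = k" by blast
    from G_eq[OF this] show ?case
      using envelope_ge[of UNIV k x "($) Y" \<psi>'] by simp
  qed
  have int_diff: "integrable \<rho> (\<lambda>x. envelope UNIV (($) Y) \<psi>' x - G x)"
    using G_int by auto
  have "(LINT x|\<rho>. envelope UNIV (($) Y) \<psi>' x - G x) \<le> 0"
    using G_int by (subst Bochner_Integration.integral_diff) auto
  then have "(LINT x|\<rho>. envelope UNIV (($) Y) \<psi>' x - G x) = 0"
    using integral_nonneg_AE[OF nonneg] by simp
  then have opt: "AE x in \<rho>. envelope UNIV (($) Y) \<psi>' x - G x = 0"
    using integral_nonneg_eq_0_iff_AE[OF int_diff nonneg] by simp
  define M where "M = card I"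
  obtain e where e: "bij_betw e {..<M} I"
    using ex_bij_betw_nat_finite[OF I(2)] by (auto simp: M_def lessThan_atLeast0)
  \<comment> \<open>Sends a fine index to the number, starting at 0, of the representative of its
    class.\<close>
  define \<sigma> where "\<sigma> k = inv_into {..<M} e (r k)" for k
  have e_\<sigma>: "e (\<sigma> k) = r k" for k
    unfolding \<sigma>_def using bij_betw_inv_into_right[OF e in_I] .
  have \<sigma>_less: "\<sigma> k < M" for k
    using bij_betwE[OF bij_betw_inv_into[OF e]] in_I by (auto simp: \<sigma>_def)
  have \<sigma>_e: "\<sigma> (e m) = m" if "m < M" for m
    using that bij_betwE[OF e] r_I bij_betw_inv_into_left[OF e] by (auto simp: \<sigma>_def)
  have range_\<sigma>: "range \<sigma> = {..<M}"
    using \<sigma>_less \<sigma>_e by (auto simp: image_iff) metis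
  \<comment> \<open>\<open>Y $ i\<close> and \<open>Y $ j\<close> give two classes; membership in
    \<open>Delta\<close> makes \<open>r\<close> non-injective, so there are fewer classes than
    indices.\<close>
  have "1 < M"
  proof -
    have "card {r i, r j} \<le> M"
      unfolding M_def using I(2) in_I by (intro card_mono) auto
    then show ?thesis using neq by (simp add: r_eq)
  qed
  moreover have "M < CARD('n)"
  proof (rule ccontr)
    assume "\<not> M < CARD('n)"
    then have "inj r"
      by (metis M_def I_def card_image_le finite_code eq_card_imp_inj_on le_antisym not_le)
    then show False
      using Y(2) by (auto simp: Delta_def inj_def r_eq)
  qed
  moreover define L' where "L' m = laguerre_cell {..<M} (\<lambda>m. Y $ e m) (\<lambda>m. \<psi> (e m)) m" for m
  have L': "L' m = laguerre_cell I (($) Y) \<psi> (e m)" if "m < M" for m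
    unfolding L'_def using that by (intro laguerre_cell_reindex[OF e]) auto
  have "inj_on (\<lambda>m. Y $ e m) {..<M}"
    using comp_inj_on[of e "{..<M}" "($) Y"] e inj_I by (simp add: bij_betw_def comp_def)
  then have "laguerre_tessellation {..<M} L'"
    unfolding laguerre_tessellation_def L'_def by blast
  moreover have "AE x in \<rho>. x \<in> L' m \<longleftrightarrow> x \<in> (\<Union>k\<in>\<sigma> -` {m}. ?L k)" if m: "m < M" for m
    using AE_cell opt AE_unique_cell[OF I(2,1) inj_I, of \<psi>]
  proof eventually_elim
    case (elim x)
    then obtain k where k: "\<forall>l\<in>UNIV. x \<in> ?L l \<longleftrightarrow> l = k" by blast
    \<comment> \<open>By \<open>opt\<close>, the affine function of index \<open>k\<close> attains
      the coarse envelope at a point of fine cell \<open>k\<close>.\<close>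
    then have "x \<in> laguerre_cell I (($) Y) \<psi> (r k)"
      using elim(2) by (simp add: mem G_eq)
    then have "x \<in> laguerre_cell I (($) Y) \<psi> l \<longleftrightarrow> l = r k" if "l \<in> I" for l
      using elim(3) in_I that by metis
    then have "x \<in> L' m \<longleftrightarrow> e m = r k"
      using m bij_betwE[OF e] by (simp add: L')
    also have "\<dots> \<longleftrightarrow> m = \<sigma> k"
      using \<sigma>_e[OF m] e_\<sigma> \<sigma>_def r_I in_I m by (metis)
    finally show ?case
      using k by auto
  qed
  ultimately show False
    using irr range_\<sigma> unfolding irreducible_laguerre_def by blast
qed

text \<open>Pulling the generators of a coarser tessellation back along \<open>\<sigma>\<close>
  gives a vector with repeated entries. It is normal at \<open>P\<close> by complementary slackness,
  but not constant as there are at least two coarse cells.\<close>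

lemma irreducible_of_normal_C:
  assumes inj: "inj (($) Y)"
    and vol: "has_volumes \<rho> v (laguerre_cell UNIV (($) Y) \<phi>)"
    and bar: "has_barycenters \<rho> v (laguerre_cell UNIV (($) Y) \<phi>) P"
    and const: "\<And>Z i j. Z \<in> normal_C P \<Longrightarrow> Z \<in> Delta \<Longrightarrow> Z $ i = Z $ j"
  shows "irreducible_laguerre \<rho> (laguerre_cell UNIV (($) Y) \<phi>)"
  unfolding irreducible_laguerre_def
proof (intro conjI notI)
  let ?L = "laguerre_cell UNIV (($) Y) \<phi>"
  show "laguerre_tessellation UNIV ?L"
    using inj by (auto simp: laguerre_tessellation_def)
  assume "\<exists>(M::nat) L' (\<sigma> :: 'n \<Rightarrow> nat).
           1 < M \<and> M < CARD('n) \<and> laguerre_tessellation {..<M} L' \<and> range \<sigma> = {..<M} \<and>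
           (\<forall>j<M. AE x in \<rho>. x \<in> L' j \<longleftrightarrow> x \<in> (\<Union>i\<in>\<sigma> -` {j}. ?L i))"
  then obtain M L' and \<sigma> :: "'n \<Rightarrow> nat" where M: "1 < M" "M < CARD('n)"
    and tess: "laguerre_tessellation {..<M} L'" and \<sigma>: "range \<sigma> = {..<M}"
    and eq: "\<And>j. j < M \<Longrightarrow> AE x in \<rho>. x \<in> L' j \<longleftrightarrow> x \<in> (\<Union>i\<in>\<sigma> -` {j}. ?L i)"
    by blast
  obtain W \<psi> where W: "inj_on W {..<M}" "\<And>j. j < M \<Longrightarrow> L' j = laguerre_cell {..<M} W \<psi> j"
    using tess by (auto simp: laguerre_tessellation_def)
  define Z where "Z = (\<chi> i. W (\<sigma> i))"
  have \<sigma>_less: "\<sigma> i < M" for i using \<sigma> by auto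
  have frac: "fractional_partition (\<lambda>i. indicator (?L i)) P"
    using inj vol bar by (rule fractional_partition_cells)
  have env: "envelope UNIV (($) Z) (\<lambda>i. \<psi> (\<sigma> i)) x = envelope {..<M} W \<psi> x" for x
    unfolding envelope_def Z_def \<sigma>[symmetric] by (simp add: image_image)
  have "AE x in \<rho>. \<forall>j\<in>{..<M}. x \<in> L' j \<longleftrightarrow> x \<in> (\<Union>i\<in>\<sigma> -` {j}. ?L i)"
    using eq by (intro AE_finite_allI) auto
  then have "inner_v v P Z = (LINT x|\<rho>. envelope UNIV (($) Z) (\<lambda>i. \<psi> (\<sigma> i)) x)
      + (\<Sum>i\<in>UNIV. v $ i * \<psi> (\<sigma> i))"
  proof (intro fractional_partition_optimal[OF frac], eventually_elim)
    case (elim x)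
    have "envelope UNIV (($) Z) (\<lambda>i. \<psi> (\<sigma> i)) x = x \<bullet> Z $ i - \<psi> (\<sigma> i)" if "x \<in> ?L i" for i
    proof -
      have "x \<in> L' (\<sigma> i)" using elim that \<sigma>_less by blast
      then show ?thesis
        unfolding env using \<sigma>_less by (simp add: Z_def W(2) mem_laguerre_cell_iff)
    qed
    then show ?case by (auto simp: indicator_def)
  qed
  then have "Z \<in> normal_C P"
    using inner_v_le_envelope by (simp add: normal_C_def)
  moreover have "Z \<in> Delta"
  proof -
    have "\<not> inj \<sigma>"
      using M(2) \<sigma> card_image[of \<sigma> UNIV] by auto
    then obtain i j where "i \<noteq> j" "\<sigma> i = \<sigma> j" by (auto simp: inj_def)
    then have "i \<noteq> j \<and> Z $ i = Z $ j" by (simp add: Z_def)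
    then show ?thesis unfolding Delta_def by blast
  qed
  moreover obtain i j where "\<sigma> i = 0" "\<sigma> j = 1"
    using M(1) \<sigma> by (metis imageE lessThan_iff order.strict_trans zero_less_one)
  ultimately have "W 0 = W 1"
    using const[of Z i j] by (simp add: Z_def)
  then show False
    using W(1) M(1) by (auto simp: inj_on_def)
qed

text \<open>All points of \<open>C_N\<close> share the mean of \<open>\<rho>\<close>, so translating
  every entry by the same vector shifts the functional by a constant on \<open>C_N\<close>.\<close>

lemma normal_C_affine:
  assumes "P \<in> C_N v \<rho>" "Z \<in> normal_C P" "0 \<le> c"
  shows "(\<chi> i. c *\<^sub>R (Z $ i - a)) \<in> normal_C P"
proof -
  have "inner_v v Q (\<chi> i. c *\<^sub>R (Z $ i - a)) = c * (inner_v v Q Z - (LINT x|\<rho>. x \<bullet> a))"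
    if "Q \<in> C_N v \<rho>" for Q
    unfolding C_N_mean[OF that, of a, symmetric]
    by (simp add: inner_v_def inner_diff_right algebra_simps sum_subtractf sum_distrib_left)
  then show ?thesis
    using assms by (auto simp: normal_C_def intro!: mult_left_mono)
qed

section \<open>Stability and the projection\<close>

lemma closed_Delta: "closed (Delta :: ((real ^ 'd) ^ 'n) set)"
proof -
  have eq: "Delta = (\<Union>i. \<Union>j\<in>{j. i \<noteq> j}. {Y :: (real ^ 'd) ^ 'n. Y $ i = Y $ j})"
    by (rule set_eqI) (simp add: Delta_def)
  have cl: "closed {Y :: (real ^ 'd) ^ 'n. Y $ i = Y $ j}" for i j
    by (intro closed_Collect_eq continuous_intros)
  show ?thesis
    unfolding eq by (intro closed_UN ballI finite cl)
qed

text \<open>Otherwise there are points of \<open>C_N\<close> converging to \<open>B\<close> with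
  nonconstant normal vectors in \<open>Delta\<close>. After normalization a subsequence of these
  converges, and the inequalities defining the normal cone pass to the limit.\<close>

lemma normal_C_Delta_nearby:
  assumes const: "\<And>Y i j. Y \<in> normal_C B \<Longrightarrow> Y \<in> Delta \<Longrightarrow> Y $ i = Y $ j"
  obtains \<epsilon> where "0 < \<epsilon>"
    "\<And>P Z i j. P \<in> C_N v \<rho> \<Longrightarrow> dist P B < \<epsilon> \<Longrightarrow> Z \<in> normal_C P \<Longrightarrow> Z \<in> Delta \<Longrightarrow> Z $ i = Z $ j"
proof (rule ccontr)
  assume contra: "\<not> thesis"
  note witness = that
  \<comment> \<open>An arbitrary index. Requiring entry 0 there leaves 0 as the only constant
    vector, which the unit sphere excludes.\<close>
  define i0 :: 'n where "i0 = undefined"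
  define K where "K = sphere 0 1 \<inter> Delta \<inter> {Z :: (real ^ 'd) ^ 'n. Z $ i0 = 0}"
  have "\<exists>P Z. P \<in> C_N v \<rho> \<and> dist P B < inverse (real (Suc n)) \<and> Z \<in> normal_C P \<and> Z \<in> K" for n
  proof -
    have "0 < inverse (real (Suc n))" by simp
    then obtain P Z i j where PZ: "P \<in> C_N v \<rho>" "dist P B < inverse (real (Suc n))"
      "Z \<in> normal_C P" "Z \<in> Delta" "Z $ i \<noteq> Z $ j"
      using contra witness[of "inverse (real (Suc n))"] by blast
    define Z0 where "Z0 = (\<chi> k. Z $ k - Z $ i0)"
    have "Z0 \<noteq> 0"
    proof
      assume "Z0 = 0"
      then have "Z0 $ k = 0" for k by simp
      then have "Z $ k = Z $ i0" for k by (simp add: Z0_def)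
      then show False using PZ(5) by metis
    qed
    define U where "U = (1 / norm Z0) *\<^sub>R Z0"
    have "norm U = 1"
      using \<open>Z0 \<noteq> 0\<close> by (simp add: U_def)
    moreover have "U $ i0 = 0"
      by (simp add: U_def Z0_def)
    moreover have "U \<in> Delta"
      using PZ(4) by (auto simp: Delta_def U_def Z0_def)
    moreover have "U = (\<chi> k. (1 / norm Z0) *\<^sub>R (Z $ k - Z $ i0))"
      by (simp add: vec_eq_iff U_def Z0_def)
    then have "U \<in> normal_C P"
      using normal_C_affine[OF PZ(1,3), of "1 / norm Z0" "Z $ i0"] by simp
    ultimately have "U \<in> normal_C P" "U \<in> K" by (auto simp: K_def)
    then show ?thesis using PZ(1,2) by blast
  qed
  then obtain P Z where PZ: "\<And>n. P n \<in> C_N v \<rho>" "\<And>n. dist (P n) B < inverse (real (Suc n))"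
    "\<And>n. Z n \<in> normal_C (P n)" "\<And>n. Z n \<in> K" by metis
  have "closed {Z :: (real ^ 'd) ^ 'n. Z $ i0 = 0}"
    by (intro closed_Collect_eq continuous_intros)
  then have "compact K"
    unfolding K_def using closed_Delta by (intro compact_Int_closed compact_sphere) auto
  then obtain Z' r where Z': "Z' \<in> K" "strict_mono r" "(Z \<circ> r) \<longlonglongrightarrow> Z'"
    using seq_compactE[OF compact_imp_seq_compact] PZ(4) by metis
  have "\<forall>\<^sub>F n in sequentially. norm (dist (P n) B) \<le> inverse (real (Suc n))"
    using less_imp_le[OF PZ(2)] by (simp del: of_nat_Suc)
  then have "(\<lambda>n. dist (P n) B) \<longlonglongrightarrow> 0"
    using LIMSEQ_inverse_real_of_nat by (rule Lim_null_comparison)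
  then have "P \<longlonglongrightarrow> B"
    by (subst tendsto_dist_iff)
  then have P_lim: "(P \<circ> r) \<longlonglongrightarrow> B"
    using Z'(2) by (rule LIMSEQ_subseq_LIMSEQ)
  note lims = tendsto_vec_nth[OF Z'(3)] tendsto_vec_nth[OF P_lim]
  have "inner_v v Q Z' \<le> inner_v v B Z'" if "Q \<in> C_N v \<rho>" for Q
  proof (rule LIMSEQ_le)
    show "(\<lambda>n. inner_v v Q ((Z \<circ> r) n)) \<longlonglongrightarrow> inner_v v Q Z'"
      unfolding inner_v_def by (intro tendsto_sum tendsto_mult tendsto_inner tendsto_const lims)
    show "(\<lambda>n. inner_v v ((P \<circ> r) n) ((Z \<circ> r) n)) \<longlonglongrightarrow> inner_v v B Z'"
      unfolding inner_v_def by (intro tendsto_sum tendsto_mult tendsto_inner tendsto_const lims)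
    show "\<exists>N. \<forall>n\<ge>N. inner_v v Q ((Z \<circ> r) n) \<le> inner_v v ((P \<circ> r) n) ((Z \<circ> r) n)"
      using PZ(3) that by (auto simp: normal_C_def)
  qed
  then have "Z' $ i = Z' $ i0" for i
    using Z'(1) by (intro const) (auto simp: normal_C_def K_def)
  then have "Z' = 0"
    using Z'(1) by (simp add: vec_eq_iff K_def)
  then show False
    using Z'(1) by (simp add: K_def)
qed

section \<open>The weighted projection\<close>

text \<open>A linear isometry from the weighted to the standard inner product, transferring
  closest-point results for Euclidean space.\<close>

definition sqrt_weighted :: "(real ^ 'd) ^ 'n \<Rightarrow> (real ^ 'd) ^ 'n" where
  "sqrt_weighted X = (\<chi> i. sqrt (v $ i) *\<^sub>R X $ i)"

lemma linear_sqrt_weighted: "linear sqrt_weighted"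
  by (intro linearI) (simp_all add: sqrt_weighted_def vec_eq_iff scaleR_add_right)

lemma inj_sqrt_weighted: "inj sqrt_weighted"
proof (rule injI)
  fix X Y assume "sqrt_weighted X = sqrt_weighted Y"
  then have "sqrt (v $ i) *\<^sub>R X $ i = sqrt (v $ i) *\<^sub>R Y $ i" for i
    by (simp add: sqrt_weighted_def vec_eq_iff)
  then show "X = Y"
    using v_pos by (simp add: vec_eq_iff less_imp_neq[symmetric])
qed

lemma inner_sqrt_weighted: "sqrt_weighted X \<bullet> sqrt_weighted Y = inner_v v X Y"
proof -
  have "sqrt (v $ i) * (sqrt (v $ i) * c) = v $ i * c" for i c
    using real_sqrt_mult_self[of "v $ i"] v_pos[of i] by (metis abs_of_pos mult.assoc)
  note [simp] = this
  show ?thesis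
    unfolding inner_vec_def[of "sqrt_weighted X"] by (simp add: sqrt_weighted_def inner_v_def)
qed

lemma norm_v_eq: "norm_v v X = norm (sqrt_weighted X)"
  by (simp add: norm_v_def norm_eq_sqrt_inner inner_sqrt_weighted)

text \<open>\<open>arg_min_on\<close> is a choice, so a minimizer is first produced as a closest
  point of the closed image. The variational inequality for the projection is then exactly normality
  of \<open>X - P\<close>.\<close>

lemma proj_C_N_props:
  fixes P X :: "(real ^ 'd) ^ 'n"
  assumes "C_N v \<rho> \<noteq> {}"
  defines "P \<equiv> proj_C_N v \<rho> X"
  shows proj_C_N_mem: "P \<in> C_N v \<rho>"
    and proj_C_N_le: "Q \<in> C_N v \<rho> \<Longrightarrow> norm_v v (P - X) \<le> norm_v v (Q - X)"
    and proj_C_N_normal: "X - P \<in> normal_C P"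
proof -
  let ?T = sqrt_weighted
  let ?S = "?T ` C_N v \<rho>"
  interpret T: linear ?T by (rule linear_sqrt_weighted)
  have S: "closed ?S" "convex ?S" "?S \<noteq> {}"
    using closed_injective_linear_image[OF closed_C_N linear_sqrt_weighted inj_sqrt_weighted]
      convex_linear_image[OF linear_sqrt_weighted convex_C_N] assms(1) by auto
  have norm_v: "norm_v v (Q - X) = dist (?T X) (?T Q)" for Q
    by (simp add: norm_v_eq T.diff dist_norm norm_minus_commute)
  obtain R' where R': "R' \<in> ?S" "\<And>y. y \<in> ?S \<Longrightarrow> dist (?T X) R' \<le> dist (?T X) y"
    using distance_attains_inf[OF S(1,3), of "?T X"] by metis
  then obtain R where "R \<in> C_N v \<rho>" "R' = ?T R" by auto
  with R'(2) have "is_arg_min (\<lambda>B. (norm_v v (B - X))\<^sup>2) (\<lambda>B. B \<in> C_N v \<rho>) R"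
    by (auto simp: is_arg_min_linorder norm_v intro!: power_mono)
  then have min: "is_arg_min (\<lambda>B. (norm_v v (B - X))\<^sup>2) (\<lambda>B. B \<in> C_N v \<rho>) P"
    unfolding P_def proj_C_N_def arg_min_on_def arg_min_def by (rule someI)
  then show P: "P \<in> C_N v \<rho>"
    by (simp add: is_arg_min_def)
  show le: "norm_v v (P - X) \<le> norm_v v (Q - X)" if "Q \<in> C_N v \<rho>" for Q
    using min that by (auto simp: is_arg_min_linorder norm_v intro: power2_le_imp_le)
  have "inner_v v (X - P) (Q - P) \<le> 0" if "Q \<in> C_N v \<rho>" for Q
    using any_closest_point_dot[OF S(2,1), of "?T P" "?T Q" "?T X"] P le that
    by (simp add: norm_v flip: T.diff inner_sqrt_weighted)
  moreover have "inner_v v (X - P) (Q - P) = inner_v v Q (X - P) - inner_v v P (X - P)" for Q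
    by (simp add: inner_v_def inner_commute inner_diff_right right_diff_distrib sum_subtractf)
  ultimately show "X - P \<in> normal_C P"
    by (simp add: normal_C_def)
qed

text \<open>Centering turns the pairing into the integral of the weighted mean gap between the
  envelope and its affine pieces. The gap vanishes only where all pieces tie, a null set once there
  are two indices.\<close>

lemma inner_v_barycenters_pos:
  fixes G :: "(real ^ 'd) ^ 'n"
  assumes inj: "inj (($) G)"
    and vol: "has_volumes \<rho> v (laguerre_cell UNIV (($) G) \<phi>)"
    and bar: "has_barycenters \<rho> v (laguerre_cell UNIV (($) G) \<phi>) B"
    and centered: "(\<Sum>i\<in>UNIV. v $ i *\<^sub>R G $ i) = 0" and "i \<noteq> (j::'n)"
  shows "0 < inner_v v B G"
proof -
  let ?E = "envelope UNIV (($) G) \<phi>"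
  define h where "h x = ?E x + (\<Sum>k\<in>UNIV. v $ k * \<phi> k)" for x
  have h: "h x = (\<Sum>k\<in>UNIV. v $ k * (?E x - (x \<bullet> G $ k - \<phi> k)))" for x
  proof -
    have "(\<Sum>k\<in>UNIV. v $ k * (x \<bullet> G $ k)) = x \<bullet> (\<Sum>k\<in>UNIV. v $ k *\<^sub>R G $ k)"
      by (simp add: inner_sum_right)
    then have "(\<Sum>k\<in>UNIV. v $ k * (x \<bullet> G $ k)) = 0"
      using centered by simp
    moreover have "(\<Sum>k\<in>UNIV. v $ k * ?E x) = ?E x"
      using v_sum by (simp flip: sum_distrib_right)
    ultimately show ?thesis
      by (simp add: h_def algebra_simps sum.distrib sum_subtractf)
  qed
  have term_nonneg: "0 \<le> v $ k * (?E x - (x \<bullet> G $ k - \<phi> k))" for k x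
    using v_pos[of k] envelope_ge[of UNIV k x "($) G" \<phi>] by simp
  have h_nonneg: "0 \<le> h x" for x
    unfolding h by (intro sum_nonneg term_nonneg)
  have int: "integrable \<rho> h"
    unfolding h_def[abs_def] by auto
  have eq: "inner_v v B G = integral\<^sup>L \<rho> h"
    unfolding h_def[abs_def] using cells_optimal[OF inj vol bar]
    by (subst Bochner_Integration.integral_add) auto
  have "integral\<^sup>L \<rho> h \<noteq> 0"
  proof
    assume "integral\<^sup>L \<rho> h = 0"
    then have "AE x in \<rho>. h x = 0"
      using integral_nonneg_eq_0_iff_AE[OF int] h_nonneg by simp
    then have "AE x in \<rho>. False"
      using AE_distinct[OF finite inj, of \<phi>]
    proof eventually_elim
      case (elim x)
      define t where "t k = v $ k * (?E x - (x \<bullet> G $ k - \<phi> k))" for k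
      have "sum t UNIV = 0"
        using elim(1) by (simp only: h t_def[abs_def])
      moreover have "0 \<le> t k" for k
        by (simp only: t_def term_nonneg)
      ultimately have "t k = 0" for k
        by (simp add: sum_nonneg_eq_0_iff)
      then have "v $ k * (?E x - (x \<bullet> G $ k - \<phi> k)) = 0" for k
        by (simp only: t_def)
      then have "?E x = x \<bullet> G $ k - \<phi> k" for k
        using v_pos[of k] by (metis eq_iff_diff_eq_0 less_irrefl mult_eq_0_iff)
      from this[of i] this[of j] show False
        using elim(2) \<open>i \<noteq> j\<close> by simp
    qed
    then show False by simp
  qed
  moreover have "0 \<le> integral\<^sup>L \<rho> h"
    using h_nonneg by simp
  ultimately show ?thesis
    using eq by simp
qed

text \<open>Translating all generators by \<open>a\<close> subtracts the same
  \<open>x \<bullet> a\<close> from every affine function and leaves the cells unchanged.\<close>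

lemma centered_generators:
  assumes "B \<in> B_iLag v \<rho>"
  obtains G \<phi> where "inj (($) (G :: (real ^ 'd) ^ 'n))" "(\<Sum>i\<in>UNIV. v $ i *\<^sub>R G $ i) = 0"
    "irreducible_laguerre \<rho> (laguerre_cell UNIV (($) G) \<phi>)"
    "has_volumes \<rho> v (laguerre_cell UNIV (($) G) \<phi>)"
    "has_barycenters \<rho> v (laguerre_cell UNIV (($) G) \<phi>) B"
proof -
  obtain L where L: "irreducible_laguerre \<rho> L" "has_volumes \<rho> v L" "has_barycenters \<rho> v L B"
    using assms by (auto simp: B_iLag_def)
  then obtain g \<phi> where g: "inj g" "\<And>i. L i = laguerre_cell UNIV g \<phi> i"
    by (auto simp: irreducible_laguerre_def laguerre_tessellation_def)
  define a where "a = (\<Sum>i\<in>UNIV. v $ i *\<^sub>R g i)"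
  define G where "G = (\<chi> i. g i - a)"
  have L_eq: "L = laguerre_cell UNIV (($) G) \<phi>"
    by (rule ext) (simp add: g(2) laguerre_cell_def G_def inner_diff_right)
  moreover have "inj (($) G)"
    using g(1) by (auto simp: G_def inj_def)
  moreover have "(\<Sum>i\<in>UNIV. v $ i *\<^sub>R G $ i) = 0"
    using v_sum by (simp add: G_def scaleR_diff_right sum_subtractf a_def[symmetric] flip: scaleR_sum_left)
  ultimately show ?thesis
    using L that[of G \<phi>] unfolding L_eq by blast
qed

lemma proj_C_N_B_iLag:
  assumes B: "B \<in> B_iLag v \<rho>"
  obtains l\<^sub>0 :: real where "1 < l\<^sub>0" and
    "\<And>l P Y. 1 < l \<Longrightarrow> l < l\<^sub>0 \<Longrightarrow> P = proj_C_N v \<rho> (l *\<^sub>R B) \<Longrightarrow> Y = l *\<^sub>R B - P \<Longrightarrow>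
       P \<in> B_iLag v \<rho> \<and> Y \<notin> Delta \<and> generators_of v \<rho> Y P"
proof -
  obtain G \<phi> where G: "inj (($) G)" "(\<Sum>i\<in>UNIV. v $ i *\<^sub>R G $ i) = 0"
    and irr: "irreducible_laguerre \<rho> (laguerre_cell UNIV (($) G) \<phi>)"
    and vol: "has_volumes \<rho> v (laguerre_cell UNIV (($) G) \<phi>)"
    and bar: "has_barycenters \<rho> v (laguerre_cell UNIV (($) G) \<phi>) B"
    using centered_generators[OF B] by blast
  have BC: "B \<in> C_N v \<rho>"
    using fractional_partition_C_N[OF fractional_partition_cells[OF G(1) vol bar]] .
  obtain \<epsilon> where \<epsilon>: "0 < \<epsilon>"
    "\<And>P Z i j. P \<in> C_N v \<rho> \<Longrightarrow> dist P B < \<epsilon> \<Longrightarrow> Z \<in> normal_C P \<Longrightarrow> Z \<in> Delta \<Longrightarrow> Z $ i = Z $ j"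
    using normal_C_Delta_nearby[OF irreducible_normal_C[OF irr G(1) vol bar]] by blast
  interpret T: linear sqrt_weighted by (rule linear_sqrt_weighted)
  obtain \<kappa> where \<kappa>: "0 < \<kappa>" "\<And>X. \<kappa> * norm X \<le> norm (sqrt_weighted X)"
    using linear_inj_bounded_below_pos[OF linear_sqrt_weighted inj_sqrt_weighted] by blast
  define b where "b = norm_v v B"
  have b: "0 \<le> b" by (simp add: b_def norm_v_eq)
  \<comment> \<open>Chosen so that \<open>l < l\<^sub>0\<close> gives
    \<open>(l - 1) * (2 * b + 1) < \<kappa> * \<epsilon>\<close>; the summand 1 keeps the
    denominator positive when \<open>b = 0\<close>.\<close>
  define l\<^sub>0 where "l\<^sub>0 = 1 + \<epsilon> * \<kappa> / (2 * b + 1)"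
  show ?thesis
  proof (rule that)
    show "1 < l\<^sub>0"
      using \<epsilon> \<kappa> b by (simp add: l\<^sub>0_def)
    fix l P Y assume l: "1 < l" "l < l\<^sub>0" and P_def: "P = proj_C_N v \<rho> (l *\<^sub>R B)"
      and Y_def: "Y = l *\<^sub>R B - P"
    have ne: "C_N v \<rho> \<noteq> {}" using BC by auto
    have P: "P \<in> C_N v \<rho>" "Y \<in> normal_C P"
      using proj_C_N_mem[OF ne] proj_C_N_normal[OF ne] by (simp_all add: P_def Y_def)
    have near: "dist P B < \<epsilon>"
    proof -
      have lB: "norm_v v (B - l *\<^sub>R B) = (l - 1) * b"
      proof -
        have "B - l *\<^sub>R B = (1 - l) *\<^sub>R B" by (simp add: algebra_simps)
        then show ?thesis using l by (simp add: norm_v_eq b_def T.scale)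
      qed
      have "\<kappa> * dist P B \<le> norm_v v (P - B)"
        using \<kappa>(2) by (simp add: dist_norm norm_v_eq)
      also have "\<dots> = norm (sqrt_weighted (P - l *\<^sub>R B) - sqrt_weighted (B - l *\<^sub>R B))"
        by (simp add: norm_v_eq flip: T.diff)
      also have "\<dots> \<le> norm_v v (P - l *\<^sub>R B) + norm_v v (B - l *\<^sub>R B)"
        unfolding norm_v_eq by (rule norm_triangle_ineq4)
      \<comment> \<open>\<open>B\<close> itself competes in the projection, so \<open>P\<close> is
        no farther from \<open>l *\<^sub>R B\<close> than \<open>B\<close> is.\<close>
      also have "\<dots> \<le> 2 * ((l - 1) * b)"
        using proj_C_N_le[OF ne BC, of "l *\<^sub>R B"] lB unfolding P_def by linarith
      also have "\<dots> \<le> (l - 1) * (2 * b + 1)"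
        using l by (simp add: algebra_simps)
      also have "\<dots> < \<kappa> * \<epsilon>"
        using l(2) b by (simp add: l\<^sub>0_def field_simps)
      finally show ?thesis using \<kappa>(1) by simp
    qed
    have "Y \<notin> Delta"
    proof
      assume Y: "Y \<in> Delta"
      \<comment> \<open>Membership in \<open>Delta\<close> supplies two distinct indices, which the
        strict positivity of \<open>inner_v v B G\<close> requires.\<close>
      then obtain i j :: 'n where ij: "i \<noteq> j" by (auto simp: Delta_def)
      have eq: "Y $ k = Y $ i" for k
        using \<epsilon>(2)[OF P(1) near P(2) Y] .
      have "inner_v v Y G = (\<Sum>k\<in>UNIV. v $ k * (Y $ i \<bullet> G $ k))"
        unfolding inner_v_def by (intro sum.cong refl) (metis eq)
      also have "\<dots> = Y $ i \<bullet> (\<Sum>k\<in>UNIV. v $ k *\<^sub>R G $ k)"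
        by (simp add: inner_sum_right)
      finally have "inner_v v Y G = Y $ i \<bullet> (\<Sum>k\<in>UNIV. v $ k *\<^sub>R G $ k)" .
      then have "inner_v v Y G = 0"
        using G(2) by simp
      moreover have "inner_v v Y G = l * inner_v v B G - inner_v v P G"
        by (simp add: Y_def inner_v_def inner_diff_left algebra_simps sum_subtractf sum_distrib_left)
      moreover have "inner_v v P G \<le> inner_v v B G"
        using inner_v_le_envelope[OF P(1), of G \<phi>] cells_optimal[OF G(1) vol bar] by simp
      moreover have "inner_v v B G < l * inner_v v B G"
        using inner_v_barycenters_pos[OF G(1) vol bar G(2) ij] l by simp
      ultimately show False by simp
    qed
    then have inj: "inj (($) Y)"
      by (auto simp: Delta_def inj_def)
    obtain \<psi> where \<psi>: "has_volumes \<rho> v (laguerre_cell UNIV (($) Y) \<psi>)"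
      using exists_volumes[OF inj] by blast
    \<comment> \<open>Kept general in the weights, since \<open>generators_of\<close> quantifies
      over all weights with volumes \<open>v\<close>.\<close>
    note bar_P = barycenters_of_normal[OF P inj]
    have "irreducible_laguerre \<rho> (laguerre_cell UNIV (($) Y) \<psi>)"
      using inj \<psi> bar_P[OF \<psi>] \<epsilon>(2)[OF P(1) near] by (rule irreducible_of_normal_C)
    then have "P \<in> B_iLag v \<rho>"
      using \<psi> bar_P[OF \<psi>] by (auto simp: B_iLag_def)
    then show "P \<in> B_iLag v \<rho> \<and> Y \<notin> Delta \<and> generators_of v \<rho> Y P"
      using \<open>Y \<notin> Delta\<close> \<psi> bar_P by (auto simp: generators_of_def)
  qed
qed

end

theorem proposition5p2:
  fixes \<rho> :: "(real ^ 'd) measure"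
    and v :: "real ^ 'n"
    and B :: "(real ^ 'd) ^ 'n"
  assumes "\<rho> \<in> P1"
    and "has_bounded_density \<rho>"
    and "\<And>i. v $ i > 0"
    and "(\<Sum>i\<in>UNIV. v $ i) = 1"
    and "B \<in> B_iLag v \<rho>"
  shows "\<exists>l\<^sub>0::real. 1 < l\<^sub>0 \<and> (\<forall>l::real. 1 < l \<and> l < l\<^sub>0 \<longrightarrow>
           (let P = proj_C_N v \<rho> (l *\<^sub>R B); Y = l *\<^sub>R B - P in
              P \<in> B_iLag v \<rho> \<and> Y \<notin> Delta \<and> generators_of v \<rho> Y P))"
proof -
  interpret laguerre_data \<rho> v
    using assms(1-4) by unfold_locales
  obtain l\<^sub>0 :: real where "1 < l\<^sub>0" and *:
    "\<And>l P Y. 1 < l \<Longrightarrow> l < l\<^sub>0 \<Longrightarrow> P = proj_C_N v \<rho> (l *\<^sub>R B) \<Longrightarrow> Y = l *\<^sub>R B - P \<Longrightarrow>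
       P \<in> B_iLag v \<rho> \<and> Y \<notin> Delta \<and> generators_of v \<rho> Y P"
    using proj_C_N_B_iLag[OF assms(5)] by blast
  then show ?thesis
    unfolding Let_def by (intro exI[of _ l\<^sub>0] conjI allI impI) (simp_all add: *[OF _ _ refl refl])
qed

end
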